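(* In the multi-armed bandit protocol with $d$ arms, let $L^\star=\min_{f\in[d]}\sum_{t=1}^T\ell_f^t$ and $\mathrm{Reg}=\max_{f\in[d]}\sum_{t=1}^T(\ell^t_{I(t)}-\ell_f^t)$. GREEN-IX with the doubling trick on $\varepsilon$ has, for any $\delta>0$, regret $$\mathrm{Reg}=\widetilde O\Big(\sqrt{d\log(d/\delta)\,L^\star}+d\log(d/\delta)\Big)$$ with probability at least $1-\delta$, and hence expected regret at most $\widetilde O\big(\sqrt{d\log(d)\,L^\star}+d\log(d)\big)$.
   Context: **Multi-armed bandit protocol.** There are $d$ arms and $T$ rounds. In each round $t$ the learner picks a distribution $w^t$ on $[d]$; the adversary picks $\ell^t\in[0,1]^d$ (possibly depending on the past, in particular on $I(1),\dots,I(t-1)$, but not on $I(t)$); the learner draws $I(t)\sim w^t$, suffers $\ell^t_{I(t)}$ and observes only $\ell^t_{I(t)}$. **GREEN-IX** with learning parameter $\varepsilon'$: set $\gamma=\frac{\varepsilon'}{d}$, $\eta=\frac{\varepsilon'}{2d}$, $\zeta=\frac{\varepsilon'}{2d}$, and $p_i^1=1/d$. In each round $t$: (1) $F^t=\{i:p_i^t<\gamma\}$; (2) $w_i^t=0$ if $i\in F^t$ and $w_i^t=p_i^t/(1-\sum_{j\in F^t}p_j^t)$ otherwise; (3) draw $I(t)\sim w^t$; (4) $\widetilde\ell_i^t=\ell_i^t/(w_i^t+\zeta)$ if $i=I(t)$ and $0$ otherwise; (5) $p_i^{t+1}\propto p_i^t\exp(-\eta\widetilde\ell_i^t)$. **Doubling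 trick.** For a constant $c>1$ and phases $\tau=0,1,2,\dots$, run a fresh copy of GREEN-IX with $\varepsilon_\tau=c^{-\tau}$ and $\varepsilon'=\varepsilon_\tau/2$, ending phase $\tau$ once $\varepsilon_\tau\widehat L_\tau>\Psi(\delta)/\varepsilon_\tau$, where $\widehat L_\tau$ is the learner's cumulative loss in phase $\tau$ and $\Psi(\delta)=\Theta(d\log(d/\delta))$. $\widetilde O(\cdot)$ hides constants and factors polylogarithmic in $d$ and $L^\star$. *)

theory Defs
  imports "HOL-Probability.Probability"
begin

section \<open>GREEN-IX\<close>

text \<open>Arms are \<open>{..<d}\<close>; vectors indexed by arms are functions on \<open>nat\<close> whose values
  outside \<open>{..<d}\<close> are never used.\<close>

definition frozen :: "nat \<Rightarrow> real \<Rightarrow> (nat \<Rightarrow> real) \<Rightarrow> nat set" where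
  "frozen d \<gamma> p = {i. i < d \<and> p i < \<gamma>}"

definition weight :: "nat \<Rightarrow> real \<Rightarrow> (nat \<Rightarrow> real) \<Rightarrow> nat \<Rightarrow> real" where
  "weight d \<gamma> p i =
     (if d \<le> i \<or> i \<in> frozen d \<gamma> p then 0 else p i / (1 - (\<Sum>j\<in>frozen d \<gamma> p. p j)))"

text \<open>The arguments of the update are the arm \<open>I\<close> that was drawn and its observed loss
  \<open>x\<close> only (bandit feedback).\<close>

definition loss_estimate ::
    "nat \<Rightarrow> real \<Rightarrow> real \<Rightarrow> (nat \<Rightarrow> real) \<Rightarrow> nat \<Rightarrow> real \<Rightarrow> nat \<Rightarrow> real" where
  "loss_estimate d \<gamma> \<zeta> p I x i = (if i = I then x / (weight d \<gamma> p i + \<zeta>) else 0)"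

definition exp_update ::
    "nat \<Rightarrow> real \<Rightarrow> (nat \<Rightarrow> real) \<Rightarrow> (nat \<Rightarrow> real) \<Rightarrow> nat \<Rightarrow> real" where
  "exp_update d \<eta> p est i = p i * exp (- \<eta> * est i) / (\<Sum>j<d. p j * exp (- \<eta> * est j))"

definition green_weight :: "nat \<Rightarrow> real \<Rightarrow> (nat \<Rightarrow> real) \<Rightarrow> nat \<Rightarrow> real" where
  "green_weight d \<epsilon>' p = weight d (\<epsilon>' / d) p"

definition green_update ::
    "nat \<Rightarrow> real \<Rightarrow> (nat \<Rightarrow> real) \<Rightarrow> nat \<Rightarrow> real \<Rightarrow> nat \<Rightarrow> real" where
  "green_update d \<epsilon>' p I x =
     (let \<gamma> = \<epsilon>' / d; \<eta> = \<epsilon>' / (2 * d); \<zeta> = \<epsilon>' / (2 * d)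
      in exp_update d \<eta> p (loss_estimate d \<gamma> \<zeta> p I x))"

text \<open>\<^const>\<open>embed_pmf\<close> is meaningful here because the weights form a probability vector, see
  \<open>pmf_green_draw\<close> and \<open>learner_state_simplex\<close> below.\<close>

definition green_draw :: "nat \<Rightarrow> real \<Rightarrow> (nat \<Rightarrow> real) \<Rightarrow> nat pmf" where
  "green_draw d \<epsilon>' p = embed_pmf (green_weight d \<epsilon>' p)"


section \<open>Doubling trick\<close>

text \<open>A learner state \<open>(\<tau>, L, p)\<close> consists of the current phase, the learner's cumulative loss
  in that phase, and the distribution maintained by the copy of GREEN-IX run in that phase.
  The number \<open>\<psi>\<close> is the value of \<open>\<Psi>(\<delta>)\<close>.\<close>

type_synonym learner_state = "nat \<times> real \<times> (nat \<Rightarrow> real)"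

definition phase_eps :: "real \<Rightarrow> nat \<Rightarrow> real" where
  "phase_eps c \<tau> = (1 / c) ^ \<tau>"

definition fresh_state :: "nat \<Rightarrow> nat \<Rightarrow> learner_state" where
  "fresh_state d \<tau> = (\<tau>, 0, \<lambda>_. 1 / d)"

fun learner_draw :: "nat \<Rightarrow> real \<Rightarrow> learner_state \<Rightarrow> nat pmf" where
  "learner_draw d c (\<tau>, L, p) = green_draw d (phase_eps c \<tau> / 2) p"

fun learner_update ::
    "nat \<Rightarrow> real \<Rightarrow> real \<Rightarrow> learner_state \<Rightarrow> nat \<Rightarrow> real \<Rightarrow> learner_state" where
  "learner_update d c \<psi> (\<tau>, L, p) I x =
     (if phase_eps c \<tau> * (L + x) > \<psi> / phase_eps c \<tau>
      then fresh_state d (Suc \<tau>)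
      else (\<tau>, L + x, green_update d (phase_eps c \<tau> / 2) p I x))"


section \<open>The bandit protocol\<close>

text \<open>A history lists, in chronological order, the drawn arm and the full loss vector of each
  round.  The learner's state depends on it only through the arms and their observed losses.\<close>

type_synonym history = "(nat \<times> (nat \<Rightarrow> real)) list"

definition learner_state :: "nat \<Rightarrow> real \<Rightarrow> real \<Rightarrow> history \<Rightarrow> learner_state" where
  "learner_state d c \<psi> h =
     foldl (\<lambda>s (I, l). learner_update d c \<psi> s I (l I)) (fresh_state d 0) h"

text \<open>The adversary is adaptive and may randomize: it maps the history of the previous rounds
  (which determines the learner's present weights) to a distribution of the next loss vector.
  Deterministic adversaries are those with values of the form \<open>return_pmf l\<close>.\<close>

type_synonym adversary = "history \<Rightarrow> (nat \<Rightarrow> real) pmf"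

definition valid_adversary :: "nat \<Rightarrow> adversary \<Rightarrow> bool" where
  "valid_adversary d adv \<longleftrightarrow> (\<forall>h. \<forall>l\<in>set_pmf (adv h). \<forall>i<d. l i \<in> {0..1})"

text \<open>Given the history, the loss vector and the arm of the next round are drawn
  independently.\<close>

primrec bandit_run ::
    "nat \<Rightarrow> real \<Rightarrow> real \<Rightarrow> adversary \<Rightarrow> nat \<Rightarrow> history pmf" where
  "bandit_run d c \<psi> adv 0 = return_pmf []"
| "bandit_run d c \<psi> adv (Suc t) =
     bind_pmf (bandit_run d c \<psi> adv t) (\<lambda>h.
     bind_pmf (adv h) (\<lambda>l.
     bind_pmf (learner_draw d c (learner_state d c \<psi> h)) (\<lambda>I.
     return_pmf (h @ [(I, l)]))))"

text \<open>Both quantities below are almost surely bounded by the number of rounds against a valid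
  adversary, so that their expectations are genuine.\<close>

definition best_loss :: "nat \<Rightarrow> history \<Rightarrow> real" where
  "best_loss d h = (MIN f\<in>{..<d}. \<Sum>(I, l)\<leftarrow>h. l f)"

definition regret :: "nat \<Rightarrow> history \<Rightarrow> real" where
  "regret d h = (MAX f\<in>{..<d}. \<Sum>(I, l)\<leftarrow>h. l I - l f)"


section \<open>Asymptotic notation\<close>

text \<open>\<open>\<Psi>(\<delta>) = \<Theta>(d log(d/\<delta>))\<close>, uniformly in the number of arms and the confidence parameter.\<close>

definition is_Theta_dlog :: "(nat \<Rightarrow> real \<Rightarrow> real) \<Rightarrow> bool" where
  "is_Theta_dlog \<Psi> \<longleftrightarrow>
     (\<exists>a>0. \<exists>b>0. \<forall>d\<ge>1. \<forall>\<delta>. 0 < \<delta> \<and> \<delta> < 1 \<longrightarrow>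
        a * (d * ln (d / \<delta>)) \<le> \<Psi> d \<delta> \<and> \<Psi> d \<delta> \<le> b * (d * ln (d / \<delta>)))"

text \<open>The factor hidden by soft-O, up to a constant.  Both logarithms exceed 1 for
  \<open>L \<ge> 0\<close>, so that the factor is also meaningful for \<open>d = 1\<close> and for small \<open>L\<close>.\<close>

definition polylog :: "nat \<Rightarrow> nat \<Rightarrow> real \<Rightarrow> real" where
  "polylog k d L = (ln (3 + real d) * ln (3 + L)) ^ k"


section \<open>Well-definedness\<close>

definition simplex_vec :: "nat \<Rightarrow> (nat \<Rightarrow> real) \<Rightarrow> bool" where
  "simplex_vec d p \<longleftrightarrow> (\<forall>i<d. 0 < p i) \<and> (\<Sum>i<d. p i) = 1"

lemma frozen_sum_less_1:
  assumes "simplex_vec d p" "0 < \<epsilon>'" "\<epsilon>' \<le> 1"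
  shows "(\<Sum>j\<in>frozen d (\<epsilon>' / d) p. p j) < 1"
proof -
  let ?F = "frozen d (\<epsilon>' / d) p"
  have F: "?F \<subseteq> {..<d}" by (auto simp: frozen_def)
  have d: "d > 0" using assms(1) by (cases d) (auto simp: simplex_vec_def)
  show ?thesis
  proof (cases "?F = {}")
    case False
    have "(\<Sum>j\<in>?F. p j) < (\<Sum>j\<in>?F. \<epsilon>' / d)"
      using False F by (intro sum_strict_mono) (auto simp: frozen_def)
    also have "\<dots> = card ?F * (\<epsilon>' / d)" by simp
    also have "\<dots> \<le> d * (\<epsilon>' / d)"
      using card_mono[OF _ F] assms(2) by (intro mult_right_mono) auto
    also have "\<dots> \<le> 1" using d assms(3) by simp
    finally show ?thesis .
  qed simp
qed

lemma pmf_green_draw: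
  assumes "simplex_vec d p" "0 < \<epsilon>'" "\<epsilon>' \<le> 1"
  shows "pmf (green_draw d \<epsilon>' p) i = green_weight d \<epsilon>' p i"
proof -
  let ?F = "frozen d (\<epsilon>' / d) p" and ?w = "green_weight d \<epsilon>' p"
  have F: "?F \<subseteq> {..<d}" by (auto simp: frozen_def)
  have S: "(\<Sum>j\<in>?F. p j) < 1" by (rule frozen_sum_less_1[OF assms])
  have nonneg: "0 \<le> ?w i" for i
    using S assms(1)
    by (auto simp: green_weight_def weight_def simplex_vec_def less_imp_le intro!: divide_nonneg_pos)
  have "(\<Sum>i<d. ?w i) = (\<Sum>i\<in>{..<d} - ?F. p i / (1 - (\<Sum>j\<in>?F. p j)))"
    by (rule sum.mono_neutral_cong_right) (auto simp: green_weight_def weight_def)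
  also have "\<dots> = (\<Sum>i\<in>{..<d} - ?F. p i) / (1 - (\<Sum>j\<in>?F. p j))"
    by (simp add: sum_divide_distrib)
  also have "(\<Sum>i\<in>{..<d} - ?F. p i) = 1 - (\<Sum>j\<in>?F. p j)"
    using F assms(1) by (simp add: sum_diff simplex_vec_def)
  finally have one: "(\<Sum>i<d. ?w i) = 1" using S by simp
  have "(\<integral>\<^sup>+ i. ennreal (?w i) \<partial>count_space UNIV) = (\<Sum>i<d. ennreal (?w i))"
    by (rule nn_integral_count_space'[of "{..<d}"])
       (auto simp: green_weight_def weight_def)
  also have "\<dots> = 1" using one nonneg by (simp add: sum_ennreal)
  finally show ?thesis
    unfolding green_draw_def by (intro pmf_embed_pmf nonneg)
qed

lemma simplex_vec_exp_update:
  assumes "simplex_vec d p"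
  shows "simplex_vec d (exp_update d \<eta> p est)"
proof -
  have "d > 0" using assms by (cases d) (auto simp: simplex_vec_def)
  then have pos: "0 < (\<Sum>j<d. p j * exp (- \<eta> * est j))"
    using assms by (intro sum_pos) (auto simp: simplex_vec_def)
  show ?thesis
    unfolding simplex_vec_def
  proof (intro conjI allI impI)
    show "0 < exp_update d \<eta> p est i" if "i < d" for i
      using that pos assms by (auto simp: exp_update_def simplex_vec_def)
    show "(\<Sum>i<d. exp_update d \<eta> p est i) = 1"
      unfolding exp_update_def sum_divide_distrib[symmetric] using pos by simp
  qed
qed

lemma learner_state_simplex:
  assumes "d \<ge> 1"
  shows "simplex_vec d (snd (snd (learner_state d c \<psi> h)))"
proof -
  have fresh: "simplex_vec d (snd (snd (fresh_state d \<tau>)))" for \<tau>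
    using assms by (auto simp: simplex_vec_def fresh_state_def)
  have upd: "simplex_vec d (snd (snd (learner_update d c \<psi> s I x)))"
    if "simplex_vec d (snd (snd s))" for s I x
    using that fresh
    by (cases s) (auto simp: green_update_def Let_def simplex_vec_exp_update)
  show ?thesis
    unfolding learner_state_def
    by (induction h rule: rev_induct) (use fresh upd in \<open>auto split: prod.splits\<close>)
qed

end

theory Submission
  imports Defs
begin

text \<open>Fix a phase with rate \<open>e\<close> (the learning parameter \<open>\<epsilon>'\<close> of its copy of GREEN-IX).  The
  exponential weights potential bounds \<open>(1 - e)\<close> times the learner's loss by the estimated loss
  of an arm plus \<open>O(d ln d / e)\<close> plus \<open>O(e / d)\<close> times the sum of all the estimated losses.
  Thanks to freezing, the estimated losses differ by at most \<open>O((d / e) ln (d / e))\<close>, so that this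
  sum is at most \<open>d\<close> times any one of them, up to a harmless term.  Implicit exploration makes
  \<open>exp ((e / d) (estimated - true loss))\<close> a supermartingale for each arm and phase, and Markov's
  inequality for a weighted sum of these bounds all deviations at once.  Thus the regret in a
  phase is at most \<open>2 e\<close> times the learner's loss plus \<open>O(d ln (d / \<delta>) / e)\<close>; these bounds form a
  geometric sum dominated by the last phase, and the loss suffered in the last but one phase
  bounds the final \<open>1 / e\<close> by the square root of the total loss.

  For the expectation, the algorithm is run with a fixed \<open>\<delta>\<close> but the deviations have exponential
  tails at every scale.\<close>

section \<open>Elementary inequalities for the logarithm and the exponential\<close>

text \<open>Both sides vanish at 0, and their difference has derivative z^2 / ((1 + z) (2 +
  z)^2).\<close>

lemma ln_add_one_lower_bound:
  fixes z :: real
  assumes "0 \<le> z"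
  shows "2 * z / (2 + z) \<le> ln (1 + z)"
proof -
  define g where "g = (\<lambda>x::real. ln (1 + x) - 2 * x / (2 + x))"
  have "g 0 \<le> g z"
  proof (rule DERIV_nonneg_imp_nondecreasing[OF assms])
    fix x :: real assume x: "0 \<le> x" "x \<le> z"
    have "(g has_real_derivative 1 / (1 + x) - (2 * (2 + x) - 2 * x) / (2 + x)^2) (at x)"
      unfolding g_def using x
      by (auto intro!: derivative_eq_intros simp: power2_eq_square field_simps)
    moreover have "0 \<le> 1 / (1 + x) - (2 * (2 + x) - 2 * x) / (2 + x)^2"
    proof -
      have "4 * (1 + x) \<le> (2 + x)^2" using zero_le_power2[of x] by (simp add: power2_sum)
      then have "4 / (2 + x)^2 \<le> 1 / (1 + x)"
        using x by (simp add: pos_divide_le_eq pos_le_divide_eq)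
      then show ?thesis by simp
    qed
    ultimately show "\<exists>y. DERIV g x :> y \<and> 0 \<le> y" by blast
  qed
  then show ?thesis by (simp add: g_def)
qed

text \<open>For an arm drawn with probability \<open>w\<close>, the left side is the mean increase
  of the exponential of \<open>2 * \<zeta>\<close> times its estimate. Because \<open>x\<close> is
  at most 1, the denominator may shrink to \<open>w + \<zeta> * x\<close>; the exponent then has
  exactly the form 2 z / (2 + z) of the preceding bound.\<close>

lemma implicit_exploration_exp:
  fixes \<zeta> w x :: real
  assumes "0 < \<zeta>" "0 \<le> w" "0 \<le> x" "x \<le> 1"
  shows "(exp (2 * \<zeta> * (x / (w + \<zeta>))) - 1) * w \<le> 2 * \<zeta> * x"
proof (cases "w = 0")
  case False
  then have w: "w > 0" using assms by simp
  define z where "z = 2 * \<zeta> * x / w"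
  have z: "z \<ge> 0" using assms w by (simp add: z_def)
  have "2 * \<zeta> * (x / (w + \<zeta>)) \<le> 2 * \<zeta> * (x / (w + \<zeta> * x))"
    using assms w
    by (intro mult_left_mono divide_left_mono) (auto simp: add_pos_nonneg mult_left_le)
  also have "\<dots> = 2 * z / (2 + z)"
    using w assms by (simp add: z_def divide_simps add_pos_nonneg)
  also have "\<dots> \<le> ln (1 + z)" by (rule ln_add_one_lower_bound[OF z])
  finally have "exp (2 * \<zeta> * (x / (w + \<zeta>))) \<le> 1 + z"
    using z by (metis add_pos_nonneg exp_le_cancel_iff exp_ln zero_less_one)
  then have "(exp (2 * \<zeta> * (x / (w + \<zeta>))) - 1) * w \<le> z * w"
    using w by (intro mult_right_mono) auto
  then show ?thesis using w by (simp add: z_def)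
qed (use assms in simp)

text \<open>The product of 1 - y + y^2 / 2 and 1 + y + y^2 / 2 is 1 + y^4 / 4, and the second factor
  is at most exp y.\<close>

lemma exp_minus_le_quadratic:
  fixes y :: real
  assumes "0 \<le> y"
  shows "exp (- y) \<le> 1 - y + y\<^sup>2 / 2"
proof -
  have pos: "0 < 1 - y + y\<^sup>2 / 2"
    using zero_le_power2[of "y - 1"] by (simp add: power2_diff)
  have "1 \<le> (1 - y + y\<^sup>2 / 2) * (1 + y + y\<^sup>2 / 2)"
    using assms by (simp add: algebra_simps power2_eq_square)
  also have "\<dots> \<le> (1 - y + y\<^sup>2 / 2) * exp y"
    using pos exp_lower_Taylor_quadratic[OF assms] by (intro mult_left_mono) auto
  finally show ?thesis by (simp add: exp_minus field_simps)
qed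

section \<open>Freezing and one round of GREEN-IX\<close>

lemma frozen_sum_le:
  assumes "simplex_vec d p" "0 < e"
  shows "(\<Sum>j\<in>frozen d (e / d) p. p j) \<le> e"
proof -
  let ?F = "frozen d (e / d) p"
  have F: "?F \<subseteq> {..<d}" by (auto simp: frozen_def)
  have d: "d > 0" using assms(1) by (cases d) (auto simp: simplex_vec_def)
  have "(\<Sum>j\<in>?F. p j) \<le> (\<Sum>j\<in>?F. e / d)"
    by (intro sum_mono) (auto simp: frozen_def)
  also have "\<dots> = card ?F * (e / d)" by simp
  also have "\<dots> \<le> d * (e / d)"
    using card_mono[OF _ F] assms(2) by (intro mult_right_mono) auto
  finally show ?thesis using d by simp
qed

lemma frozen_sum_nonneg:
  assumes "simplex_vec d p"
  shows "0 \<le> (\<Sum>j\<in>frozen d \<gamma> p. p j)"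
  using assms by (intro sum_nonneg) (auto simp: frozen_def simplex_vec_def less_imp_le)

lemma green_weight_nonneg:
  assumes "simplex_vec d p" "0 < e" "e \<le> 1"
  shows "0 \<le> green_weight d e p i"
  using pmf_green_draw[OF assms, of i] by (metis pmf_nonneg)

lemma set_pmf_green_draw:
  assumes "simplex_vec d p" "0 < e" "e \<le> 1"
  shows "set_pmf (green_draw d e p) \<subseteq> {..<d} - frozen d (e / d) p"
proof
  fix i assume "i \<in> set_pmf (green_draw d e p)"
  then have "green_weight d e p i \<noteq> 0"
    using pmf_green_draw[OF assms, of i] by (simp add: set_pmf_iff)
  then show "i \<in> {..<d} - frozen d (e / d) p"
    by (auto simp: green_weight_def weight_def split: if_splits)
qed

text \<open>Frozen arms have total mass at most \<open>e\<close>, so renormalising divides by a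
  number between \<open>1 - e\<close> and 1. Of the two comparisons with \<open>p\<close>, the first
  controls the second-order term of the potential and the second its linear term.\<close>

lemma green_weight_bounds:
  assumes "simplex_vec d p" "0 < e" "e < 1" "i < d" "i \<notin> frozen d (e / d) p"
  shows "e / d \<le> p i" "p i \<le> green_weight d e p i" "(1 - e) * green_weight d e p i \<le> p i"
proof -
  define P where "P = (\<Sum>j\<in>frozen d (e / d) p. p j)"
  have P: "0 \<le> P" "P \<le> e"
    using frozen_sum_nonneg[OF assms(1)] frozen_sum_le[OF assms(1,2)] by (auto simp: P_def)
  have pos: "p i > 0" using assms by (simp add: simplex_vec_def)
  have w: "green_weight d e p i = p i / (1 - P)"
    using assms(4,5) by (auto simp: green_weight_def weight_def P_def)
  show "e / d \<le> p i" using assms(4,5) by (auto simp: frozen_def)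
  show "p i \<le> green_weight d e p i"
    using P pos assms(3) by (simp add: w field_simps)
  have "(1 - e) * p i \<le> p i * (1 - P)"
    using P pos by (simp add: algebra_simps mult_left_mono)
  then show "(1 - e) * green_weight d e p i \<le> p i"
    using P assms(3) by (simp add: w field_simps)
qed

text \<open>Only the drawn arm changes, so the sum is 1 plus a small term, to which ln (1 + u) \<le>
  u and the second-order bound of the exponential apply.\<close>

lemma exp_update_potential_step:
  fixes d :: nat and e \<zeta> \<eta> x :: real and p :: "nat \<Rightarrow> real" and I :: nat
  defines "est \<equiv> loss_estimate d (e / d) \<zeta> p I x"
  assumes p: "simplex_vec d p" and e: "0 < e" "e < 1" and I: "I < d" "I \<notin> frozen d (e / d) p"
    and x: "0 \<le> x" "x \<le> 1" and \<eta>: "0 \<le> \<eta>" and \<zeta>: "0 \<le> \<zeta>"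
  shows "ln (\<Sum>j<d. p j * exp (- \<eta> * est j))
           \<le> - \<eta> * (1 - e) * (x - \<zeta> * est I) + \<eta>\<^sup>2 / 2 * est I"
proof -
  define v where "v = est I"
  define w where "w = green_weight d e p I"
  note b = green_weight_bounds[OF p e I, folded w_def]
  have pI: "p I > 0" using p I by (simp add: simplex_vec_def)
  then have w: "w > 0" using b by linarith
  have v: "v = x / (w + \<zeta>)"
    by (simp add: v_def est_def loss_estimate_def w_def green_weight_def)
  have v0: "v \<ge> 0" unfolding v using x w \<zeta> by simp
  \<comment> \<open>\<open>w * v\<close> is the loss itself, up to the bias
    \<open>\<zeta> * v\<close> of implicit exploration.\<close>
  have wv: "w * v = x - \<zeta> * v" unfolding v using w \<zeta> by (simp add: field_simps)
  have wv1: "w * v \<le> 1" using wv v0 \<zeta> x by (smt (verit) mult_nonneg_nonneg)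
  have "(\<Sum>j<d. p j * exp (- \<eta> * est j)) = (\<Sum>j<d. p j + (if j = I then p I * (exp (- \<eta> * v) - 1) else 0))"
    by (intro sum.cong) (auto simp: v_def est_def loss_estimate_def algebra_simps)
  also have "\<dots> = 1 + p I * (exp (- \<eta> * v) - 1)"
    using p I by (simp add: sum.distrib simplex_vec_def)
  finally have sum: "(\<Sum>j<d. p j * exp (- \<eta> * est j)) = 1 + p I * (exp (- \<eta> * v) - 1)" .
  have pI1: "p I \<le> 1"
    using p I member_le_sum[of I "{..<d}" p] by (auto simp: simplex_vec_def less_imp_le)
  have y: "0 \<le> \<eta> * v" using \<eta> v0 by simp
  have E: "exp (- \<eta> * v) - 1 \<le> - \<eta> * v + \<eta>\<^sup>2 / 2 * v\<^sup>2"
    using exp_minus_le_quadratic[OF y] by (simp add: power_mult_distrib)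
  \<comment> \<open>One factor of the squared estimate is paid for by the probability of the arm,
    since \<open>w * v\<close> is at most 1.\<close>
  have pv: "p I * v\<^sup>2 \<le> v"
  proof -
    have "p I * v\<^sup>2 \<le> w * v\<^sup>2" using b by (intro mult_right_mono) auto
    also have "\<dots> = (w * v) * v" by (simp add: power2_eq_square)
    also have "\<dots> \<le> 1 * v" using wv1 v0 by (intro mult_right_mono)
    finally show ?thesis by simp
  qed
  have pv': "(1 - e) * (x - \<zeta> * v) \<le> p I * v"
    using mult_right_mono[OF b(3) v0] by (simp add: wv[symmetric] mult.assoc)
  have pos: "0 < 1 + p I * (exp (- \<eta> * v) - 1)"
  proof -
    have "1 + p I * (exp (- \<eta> * v) - 1) = (1 - p I) + p I * exp (- \<eta> * v)" by (simp add: algebra_simps)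
    also have "\<dots> > 0" using pI pI1 by (intro add_nonneg_pos) auto
    finally show ?thesis .
  qed
  have "ln (1 + p I * (exp (- \<eta> * v) - 1)) \<le> p I * (exp (- \<eta> * v) - 1)"
    using pos ln_le_minus_one by fastforce
  also have "\<dots> \<le> p I * (- \<eta> * v + \<eta>\<^sup>2 / 2 * v\<^sup>2)"
    using E pI by (intro mult_left_mono) auto
  also have "\<dots> = - \<eta> * (p I * v) + \<eta>\<^sup>2 / 2 * (p I * v\<^sup>2)" by (simp add: algebra_simps)
  also have "\<dots> \<le> - \<eta> * ((1 - e) * (x - \<zeta> * v)) + \<eta>\<^sup>2 / 2 * v"
    using pv pv' \<eta> by (intro add_mono mult_left_mono mult_left_mono_neg) auto
  finally show ?thesis unfolding sum v_def[symmetric] by (simp add: mult.assoc)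
qed

text \<open>The estimate of \<open>f\<close> is nonzero only if \<open>f\<close> is drawn, so the
  integral is an explicit expression in \<open>w\<close>, bounded by
  \<open>implicit_exploration_exp\<close> and 1 + u \<le> exp u. This is the one-round step of the
  supermartingale.\<close>

lemma nn_integral_implicit_exploration:
  assumes p: "simplex_vec d p" and e: "0 < e" "e \<le> 1" and \<zeta>: "0 < \<zeta>"
    and x: "0 \<le> l f" "l f \<le> 1"
  shows "(\<integral>\<^sup>+ I. ennreal (exp (2 * \<zeta> * (loss_estimate d (e / d) \<zeta> p I (l I) f - l f)))
           \<partial>green_draw d e p) \<le> 1"
proof -
  define w where "w = green_weight d e p f"
  define a where "a = exp (2 * \<zeta> * (l f / (w + \<zeta>))) - 1"
  have w: "0 \<le> w" using green_weight_nonneg[OF p e] by (simp add: w_def)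
  have a: "0 \<le> a" using w x \<zeta> by (simp add: a_def)
  have aw: "a * w \<le> 2 * \<zeta> * l f"
    unfolding a_def using implicit_exploration_exp[OF \<zeta> w x] .
  have "ennreal (exp (2 * \<zeta> * (loss_estimate d (e / d) \<zeta> p I (l I) f - l f)))
      = ennreal (exp (- (2 * \<zeta> * l f))) * (1 + ennreal a * indicator {f} I)" for I
  proof (cases "I = f")
    case True
    have "exp (2 * \<zeta> * (l f / (w + \<zeta>) - l f)) = exp (- (2 * \<zeta> * l f)) * (1 + a)"
      by (simp add: a_def exp_add[symmetric] algebra_simps)
    then show ?thesis using True a
      by (simp add: loss_estimate_def w_def green_weight_def ennreal_mult)
  qed (auto simp: loss_estimate_def)
  then have "(\<integral>\<^sup>+ I. ennreal (exp (2 * \<zeta> * (loss_estimate d (e / d) \<zeta> p I (l I) f - l f))) \<partial>green_draw d e p)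
      = ennreal (exp (- (2 * \<zeta> * l f))) * (1 + ennreal a * ennreal w)"
    by (simp add: nn_integral_cmult nn_integral_add emeasure_pmf_single pmf_green_draw[OF p e] w_def)
  also have "\<dots> = ennreal (exp (- (2 * \<zeta> * l f)) * (1 + a * w))"
    using a w by (simp add: ennreal_mult)
  also have "\<dots> \<le> ennreal 1"
  proof (rule ennreal_leI)
    have "1 + a * w \<le> exp (2 * \<zeta> * l f)" using aw exp_ge_add_one_self[of "2 * \<zeta> * l f"] by linarith
    then have "exp (- (2 * \<zeta> * l f)) * (1 + a * w) \<le> exp (- (2 * \<zeta> * l f)) * exp (2 * \<zeta> * l f)"
      by (intro mult_left_mono) auto
    then show "exp (- (2 * \<zeta> * l f)) * (1 + a * w) \<le> 1" by (simp add: exp_add[symmetric])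
  qed
  finally show ?thesis by simp
qed

section \<open>Pathwise analysis\<close>

locale green_ix =
  fixes d :: nat and c \<psi> :: real
  assumes d_ge_1: "d \<ge> 1" and c_gt_1: "c > 1" and psi_pos: "\<psi> > 0"
begin

abbreviation state :: "history \<Rightarrow> learner_state" where
  "state \<equiv> learner_state d c \<psi>"

abbreviation phase :: "history \<Rightarrow> nat" where
  "phase h \<equiv> fst (state h)"

abbreviation arm_dist :: "history \<Rightarrow> nat \<Rightarrow> real" where
  "arm_dist h \<equiv> snd (snd (state h))"

definition rate :: "nat \<Rightarrow> real" where
  "rate \<tau> = phase_eps c \<tau> / 2"

lemma rate_pos: "rate \<tau> > 0" and rate_le: "rate \<tau> \<le> 1 / 2"
  using c_gt_1 by (auto simp: rate_def phase_eps_def power_le_one)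

lemma simplex_arm_dist: "simplex_vec d (arm_dist h)"
  using learner_state_simplex[OF d_ge_1] .

lemma state_Nil [simp]: "state [] = (0, 0, \<lambda>_. 1 / d)"
  by (simp add: learner_state_def fresh_state_def)

lemma state_snoc: "state (h @ [(I, l)]) = learner_update d c \<psi> (state h) I (l I)"
  by (simp add: learner_state_def)

lemma phase_snoc: "phase (h @ [z]) = phase h \<or> phase (h @ [z]) = Suc (phase h)"
  by (cases z; cases "state h") (auto simp: state_snoc fresh_state_def)

lemma phase_le_length: "phase h \<le> length h"
proof (induction h rule: rev_induct)
  case (snoc z h)
  then show ?case using phase_snoc[of h z] by auto
qed simp

section \<open>Sums over a phase and the closed form of the weights\<close>

text \<open>A round belongs to the phase in force before it is played, and \<open>\<phi>\<close>
  also receives the arm distribution of that moment. As \<open>\<tau>\<close> is a parameter, one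
  final history yields the sums of all phases, finished ones included.\<close>

definition phase_sum ::
    "nat \<Rightarrow> ((nat \<Rightarrow> real) \<Rightarrow> nat \<times> (nat \<Rightarrow> real) \<Rightarrow> real) \<Rightarrow> history \<Rightarrow> real" where
  "phase_sum \<tau> \<phi> h =
     (\<Sum>t<length h. if phase (take t h) = \<tau> then \<phi> (arm_dist (take t h)) (h ! t) else 0)"

lemma phase_sum_Nil [simp]: "phase_sum \<tau> \<phi> [] = 0"
  by (simp add: phase_sum_def)

lemma phase_sum_snoc [simp]:
  "phase_sum \<tau> \<phi> (h @ [z]) = phase_sum \<tau> \<phi> h + (if phase h = \<tau> then \<phi> (arm_dist h) z else 0)"
  unfolding phase_sum_def
  by (auto simp: nth_append intro!: sum.cong)

lemma phase_sum_future: "phase h < \<tau> \<Longrightarrow> phase_sum \<tau> \<phi> h = 0"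
proof (induction h rule: rev_induct)
  case (snoc z h)
  then show ?case using phase_snoc[of h z] by auto
qed simp

definition player_loss :: "nat \<Rightarrow> history \<Rightarrow> real" where
  "player_loss \<tau> = phase_sum \<tau> (\<lambda>p (I, l). l I)"

definition arm_loss :: "nat \<Rightarrow> nat \<Rightarrow> history \<Rightarrow> real" where
  "arm_loss \<tau> f = phase_sum \<tau> (\<lambda>p (I, l). l f)"

definition est_loss :: "nat \<Rightarrow> nat \<Rightarrow> history \<Rightarrow> real" where
  "est_loss \<tau> f = phase_sum \<tau>
     (\<lambda>p (I, l). loss_estimate d (rate \<tau> / d) (rate \<tau> / (2 * d)) p I (l I) f)"

lemma sum_phases:
  assumes "phase h \<le> N"
  shows "(\<Sum>\<tau>\<le>N. phase_sum \<tau> (\<lambda>p. \<phi>) h) = (\<Sum>z\<leftarrow>h. \<phi> z)"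
  using assms
proof (induction h rule: rev_induct)
  case (snoc z h)
  then have "phase h \<le> N" using phase_snoc[of h z] by auto
  then show ?case using snoc.IH by (simp add: sum.distrib)
qed simp

text \<open>Within a phase the successive normalisations cancel, which leaves the closed form of
  exponential weights started from the uniform distribution. A restart agrees with it because the
  sums of a new phase are zero.\<close>

lemma state_invariant:
  shows "fst (snd (state h)) = player_loss (phase h) h"
    and "i < d \<Longrightarrow> arm_dist h i =
           exp (- (rate (phase h) / (2 * d)) * est_loss (phase h) i h) /
           (\<Sum>j<d. exp (- (rate (phase h) / (2 * d)) * est_loss (phase h) j h))"
proof (induction h arbitrary: i rule: rev_induct)
  case Nil
  { case 1 show ?case by (simp add: player_loss_def) next
    case 2 show ?case by (simp add: est_loss_def) }
next
  case (snoc z h)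
  obtain I l where z: "z = (I, l)" by (cases z)
  obtain k L p where st: "state h = (k, L, p)" by (cases "state h")
  { case 1
    show ?case
      using snoc.IH(1) phase_sum_future[of h "Suc k"]
      by (auto simp: st z state_snoc player_loss_def fresh_state_def)
  next
    case (2 i)
    then have i: "i < d" .
    show ?case
  proof (cases "phase_eps c k * (L + l I) > \<psi> / phase_eps c k")
    case True
    then have "state (h @ [z]) = fresh_state d (Suc k)" by (simp add: st z state_snoc)
    then show ?thesis
      using phase_sum_future[of h "Suc k"] by (simp add: st est_loss_def fresh_state_def)
  next
    case False
    then have st': "state (h @ [z]) = (k, L + l I, green_update d (rate k) p I (l I))"
      by (simp add: st z state_snoc rate_def)
    define \<eta> where "\<eta> = rate k / (2 * d)"
    define e where "e = loss_estimate d (rate k / d) \<eta> p I (l I)"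
    define W where "W = (\<Sum>j<d. exp (- \<eta> * est_loss k j h))"
    have W: "W > 0" unfolding W_def using i by (intro sum_pos) auto
    have p: "p j = exp (- \<eta> * est_loss k j h) / W" if "j < d" for j
      using snoc.IH(2)[OF that] by (simp add: st \<eta>_def W_def)
    have E: "exp (- \<eta> * est_loss k j (h @ [z])) = W * (p j * exp (- \<eta> * e j))" if "j < d" for j
    proof -
      have "est_loss k j (h @ [z]) = est_loss k j h + e j"
        by (simp add: est_loss_def st z e_def \<eta>_def)
      then show ?thesis
        using W p[OF that] by (simp add: exp_add[symmetric] algebra_simps)
    qed
    have "arm_dist (h @ [z]) i = p i * exp (- \<eta> * e i) / (\<Sum>j<d. p j * exp (- \<eta> * e j))"
      by (simp add: st' green_update_def Let_def exp_update_def e_def \<eta>_def)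
    also have "\<dots> = (W * (p i * exp (- \<eta> * e i))) / (\<Sum>j<d. W * (p j * exp (- \<eta> * e j)))"
      unfolding sum_distrib_left[symmetric] using W by simp
    also have "\<dots> = exp (- \<eta> * est_loss k i (h @ [z])) / (\<Sum>j<d. exp (- \<eta> * est_loss k j (h @ [z])))"
      using i E by (intro arg_cong2[where f = "(/)"] sum.cong) auto
    finally show ?thesis by (simp add: st' \<eta>_def)
  qed }
qed

section \<open>Feasible histories and single-round bounds\<close>

text \<open>Lets the pathwise bounds proceed without probabilities: by
  \<open>feasible_bandit_run\<close> it holds throughout the support of every run against a valid
  adversary.\<close>

inductive feasible :: "history \<Rightarrow> bool" where
  Nil: "feasible []"
| snoc: "\<lbrakk>feasible h; \<forall>i<d. l i \<in> {0..1}; I < d; I \<notin> frozen d (rate (phase h) / d) (arm_dist h)\<rbrakk>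
     \<Longrightarrow> feasible (h @ [(I, l)])"

lemma learner_draw_state: "learner_draw d c (state h) = green_draw d (rate (phase h)) (arm_dist h)"
  by (cases "state h") (simp add: rate_def)

lemma feasible_bandit_run:
  assumes "valid_adversary d adv" "h \<in> set_pmf (bandit_run d c \<psi> adv T)"
  shows "feasible h \<and> length h = T"
  using assms(2)
proof (induction T arbitrary: h)
  case 0
  then show ?case by (simp add: feasible.Nil)
next
  case (Suc T)
  then obtain h' l I where *: "h' \<in> set_pmf (bandit_run d c \<psi> adv T)" "l \<in> set_pmf (adv h')"
    "I \<in> set_pmf (learner_draw d c (state h'))" "h = h' @ [(I, l)]"
    by (auto simp: set_bind_pmf)
  have "I \<in> {..<d} - frozen d (rate (phase h') / d) (arm_dist h')"
    using *(3) set_pmf_green_draw[OF simplex_arm_dist rate_pos, of "phase h'" h'] rate_le[of "phase h'"]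
    by (auto simp: learner_draw_state)
  then show ?case
    using Suc.IH[OF *(1)] * assms(1) by (auto simp: valid_adversary_def intro!: feasible.snoc)
qed

definition step_est :: "history \<Rightarrow> nat \<Rightarrow> (nat \<Rightarrow> real) \<Rightarrow> nat \<Rightarrow> real" where
  "step_est h I l =
     loss_estimate d (rate (phase h) / d) (rate (phase h) / (2 * d)) (arm_dist h) I (l I)"

lemma est_loss_snoc:
  "est_loss \<tau> f (h @ [(I, l)]) = est_loss \<tau> f h + (if phase h = \<tau> then step_est h I l f else 0)"
  by (auto simp: est_loss_def step_est_def)

lemma player_loss_snoc:
  "player_loss \<tau> (h @ [(I, l)]) = player_loss \<tau> h + (if phase h = \<tau> then l I else 0)"
  by (simp add: player_loss_def)

lemma arm_loss_snoc:
  "arm_loss \<tau> f (h @ [(I, l)]) = arm_loss \<tau> f h + (if phase h = \<tau> then l f else 0)"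
  by (simp add: arm_loss_def)

lemma step_est_other: "f \<noteq> I \<Longrightarrow> step_est h I l f = 0"
  by (simp add: step_est_def loss_estimate_def)

text \<open>A drawn arm is not frozen, so its weight is at least \<open>rate (phase h) / d\<close>;
  this caps a single estimate.\<close>

lemma step_est_drawn_bounds:
  assumes "0 \<le> l I" "l I \<le> 1" "I < d" "I \<notin> frozen d (rate (phase h) / d) (arm_dist h)"
  shows "0 \<le> step_est h I l I" "step_est h I l I \<le> d / rate (phase h)"
proof -
  let ?e = "rate (phase h)"
  let ?w = "weight d (?e / d) (arm_dist h) I"
  have e: "0 < ?e" "?e < 1" using rate_pos rate_le[of "phase h"] by auto
  have "?e / d \<le> ?w"
    using green_weight_bounds(1,2)[OF simplex_arm_dist e assms(3,4)] by (simp add: green_weight_def)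
  moreover have g: "0 < ?e / d" "0 < ?e / (2 * d)" using e assms(3) by auto
  ultimately have w: "?w > 0" "?e / d \<le> ?w + ?e / (2 * d)" by linarith+
  show "0 \<le> step_est h I l I"
    using w g assms(1) by (simp add: step_est_def loss_estimate_def)
  have "step_est h I l I \<le> 1 / (?e / d)"
    unfolding step_est_def loss_estimate_def
    using w g assms(1,2) by (simp del: divide_divide_eq_right) (intro frac_le; simp)
  then show "step_est h I l I \<le> d / rate (phase h)" by simp
qed

lemma est_loss_nonneg:
  assumes "feasible h" "f < d"
  shows "0 \<le> est_loss \<tau> f h"
  using assms(1)
proof induction
  case Nil
  then show ?case by (simp add: est_loss_def)
next
  case (snoc h l I)
  have "0 \<le> step_est h I l f"
    using step_est_drawn_bounds(1)[of l I h] step_est_other[of f I h l] snoc by (cases "f = I") auto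
  then show ?case using snoc.IH by (simp add: est_loss_snoc)
qed

lemma player_loss_nonneg:
  assumes "feasible h"
  shows "0 \<le> player_loss \<tau> h"
  using assms
proof induction
  case Nil
  then show ?case by (simp add: player_loss_def)
qed (auto simp: player_loss_snoc)

section \<open>Exponential weights potential within one phase\<close>

text \<open>The bound of \<open>exp_update_potential_step\<close> is summed over the rounds of the
  phase, starting from \<open>ln d\<close> for zero estimates. The exploration parameter equals the
  learning rate, so \<open>\<eta>\<close> plays both roles.\<close>

lemma potential_bound:
  fixes \<tau> :: nat and h :: history
  defines "e \<equiv> rate \<tau>" and "\<eta> \<equiv> rate \<tau> / (2 * d)"
  defines "S \<equiv> \<lambda>h. \<Sum>i<d. est_loss \<tau> i h"
  assumes "feasible h"
  shows "ln (\<Sum>j<d. exp (- \<eta> * est_loss \<tau> j h))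
           \<le> ln d - \<eta> * (1 - e) * (player_loss \<tau> h - \<eta> * S h) + \<eta>\<^sup>2 / 2 * S h"
  using assms(4)
proof induction
  case Nil
  then show ?case by (simp add: est_loss_def player_loss_def S_def)
next
  case (snoc h l I)
  show ?case
  proof (cases "phase h = \<tau>")
    case False
    then show ?thesis using snoc.IH by (simp add: est_loss_snoc player_loss_snoc S_def)
  next
    case True
    define v where "v = step_est h I l"
    define W where "W = (\<Sum>j<d. exp (- \<eta> * est_loss \<tau> j h))"
    define p where "p = arm_dist h"
    have W: "W > 0" unfolding W_def using snoc.hyps(3) by (intro sum_pos) auto
    have p: "p j = exp (- \<eta> * est_loss \<tau> j h) / W" if "j < d" for j
      unfolding p_def using state_invariant(2)[OF that, of h] by (simp add: True \<eta>_def W_def)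
    \<comment> \<open>By the closed form of the weights, the new sum is the old one times the
      normaliser of the update, so the logarithms add up.\<close>
    have "(\<Sum>j<d. exp (- \<eta> * est_loss \<tau> j (h @ [(I, l)]))) = (\<Sum>j<d. W * (p j * exp (- \<eta> * v j)))"
      using W p by (intro sum.cong) (auto simp: est_loss_snoc True v_def exp_add[symmetric] algebra_simps)
    also have "\<dots> = W * (\<Sum>j<d. p j * exp (- \<eta> * v j))" by (simp add: sum_distrib_left)
    finally have W': "(\<Sum>j<d. exp (- \<eta> * est_loss \<tau> j (h @ [(I, l)]))) =
      W * (\<Sum>j<d. p j * exp (- \<eta> * v j))" .
    have s: "simplex_vec d p" by (simp add: p_def simplex_arm_dist)
    have pos: "(\<Sum>j<d. p j * exp (- \<eta> * v j)) > 0"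
      using s snoc.hyps(3) by (intro sum_pos) (auto simp: simplex_vec_def)
    have e: "0 < e" "e < 1" using rate_pos rate_le[of \<tau>] by (auto simp: e_def)
    have "I \<notin> frozen d (e / d) p" using snoc.hyps by (simp add: True e_def p_def)
    moreover have "0 \<le> \<eta>" using e by (simp add: \<eta>_def e_def)
    moreover have "v = loss_estimate d (e / d) \<eta> p I (l I)"
      by (simp add: v_def step_est_def True e_def p_def \<eta>_def)
    ultimately have "ln (\<Sum>j<d. p j * exp (- \<eta> * v j))
        \<le> - \<eta> * (1 - e) * (l I - \<eta> * v I) + \<eta>\<^sup>2 / 2 * v I"
      using exp_update_potential_step[OF s e snoc.hyps(3), of "l I" \<eta> \<eta>] snoc.hyps
      by simp
    moreover have "S (h @ [(I, l)]) = S h + v I"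
    proof -
      have "(\<Sum>i<d. v i) = v I"
        using snoc.hyps(3) step_est_other[of _ I h l]
        by (subst sum.remove[of _ I]) (auto simp: v_def)
      then show ?thesis by (simp add: S_def est_loss_snoc True sum.distrib v_def)
    qed
    ultimately show ?thesis
      unfolding W' ln_mult_pos[OF W pos]
      using snoc.IH by (simp add: W_def player_loss_snoc True algebra_simps add_divide_distrib)
  qed
qed

text \<open>Freezing keeps all the estimates within the same distance from each other: an arm can only
  be drawn while its estimate is not much larger than the others.\<close>

lemma est_loss_spread:
  fixes \<tau> :: nat and h :: history
  defines "e \<equiv> rate \<tau>"
  assumes "feasible h" "i < d" "f < d"
  shows "est_loss \<tau> i h \<le> est_loss \<tau> f h + 2 * d / e * ln (d / e) + d / e"
  using assms(2)
proof induction
  case Nil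
  have "e \<le> d" using rate_le[of \<tau>] d_ge_1 by (simp add: e_def)
  then have "ln (d / e) \<ge> 0" using rate_pos[of \<tau>] by (simp add: e_def)
  then show ?case using rate_pos[of \<tau>] by (simp add: est_loss_def e_def)
next
  case (snoc h l I)
  have e: "0 < e" "e < 1" using rate_pos rate_le[of \<tau>] by (auto simp: e_def)
  have v: "0 \<le> step_est h I l j" if "j < d" for j
    using step_est_drawn_bounds(1)[of l I h] step_est_other[of j I h l] snoc by (cases "j = I") auto
  show ?case
  \<comment> \<open>Every other round leaves the estimate of \<open>i\<close> unchanged and can only
    raise that of \<open>f\<close>.\<close>
  proof (cases "phase h = \<tau> \<and> I = i")
    case False
    then show ?thesis using snoc.IH v[of f] assms(4) by (auto simp: est_loss_snoc step_est_other)
  next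
    case True
    define \<eta> where "\<eta> = e / (2 * d)"
    have \<eta>: "\<eta> > 0" using e d_ge_1 by (simp add: \<eta>_def)
    define W where "W = (\<Sum>j<d. exp (- \<eta> * est_loss \<tau> j h))"
    \<comment> \<open>The drawn arm has probability at least \<open>e / d\<close>, while the
      normaliser is at least the term of \<open>f\<close>. Taking logarithms bounds the gap just
      before the draw; the draw itself adds at most \<open>d / e\<close>.\<close>
    have "exp (- \<eta> * est_loss \<tau> f h) \<le> W"
      unfolding W_def using assms(4) by (intro member_le_sum) auto
    moreover have "e / d \<le> arm_dist h i"
      using snoc.hyps True assms(3) by (auto simp: frozen_def e_def)
    moreover have "arm_dist h i = exp (- \<eta> * est_loss \<tau> i h) / W"
      using state_invariant(2)[OF assms(3), of h] True by (simp add: \<eta>_def e_def W_def)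
    moreover have W: "W > 0" unfolding W_def using assms(3) by (intro sum_pos) auto
    ultimately have "(e / d) * exp (- \<eta> * est_loss \<tau> f h) \<le> exp (- \<eta> * est_loss \<tau> i h)"
    proof -
      assume a: "exp (- \<eta> * est_loss \<tau> f h) \<le> W" "e / d \<le> arm_dist h i"
        "arm_dist h i = exp (- \<eta> * est_loss \<tau> i h) / W" "W > 0"
      have "(e / d) * exp (- \<eta> * est_loss \<tau> f h) \<le> (e / d) * W"
        using a e by (intro mult_left_mono) auto
      also have "\<dots> \<le> arm_dist h i * W" using a by (intro mult_right_mono) auto
      finally show ?thesis using a by simp
    qed
    then have "ln ((e / d) * exp (- \<eta> * est_loss \<tau> f h)) \<le> ln (exp (- \<eta> * est_loss \<tau> i h))"
      using e d_ge_1 by (subst ln_le_cancel_iff) auto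
    moreover have "ln (e / d) = - ln (d / e)" using e d_ge_1 by (simp add: ln_div)
    ultimately have "\<eta> * est_loss \<tau> i h \<le> \<eta> * est_loss \<tau> f h + ln (d / e)"
      using e d_ge_1 by (subst (asm) ln_mult_pos) auto
    then have "est_loss \<tau> i h \<le> est_loss \<tau> f h + ln (d / e) / \<eta>"
      using \<eta> by (simp add: field_simps)
    moreover have "ln (d / e) / \<eta> = 2 * d / e * ln (d / e)" by (simp add: \<eta>_def)
    moreover have "step_est h I l i \<le> d / e"
      using step_est_drawn_bounds(2)[of l I h] snoc.hyps True by (auto simp: e_def)
    ultimately show ?thesis using True v[OF assms(4)] by (simp add: est_loss_snoc)
  qed
qed

text \<open>Keeping only arm \<open>f\<close> bounds the potential from below. By
  \<open>est_loss_spread\<close>, \<open>S\<close> is at most \<open>d\<close> times the estimate of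
  \<open>f\<close> plus an additive term; since \<open>\<eta> * d = e / 2\<close>, this costs at
  most a factor \<open>1 + e\<close> on that estimate.\<close>

lemma phase_loss_estimate:
  fixes \<tau> :: nat
  defines "e \<equiv> rate \<tau>"
  assumes h: "feasible h" and f: "f < d"
  shows "(1 - e) * player_loss \<tau> h
           \<le> (1 + e) * est_loss \<tau> f h + d / e * (4 * ln d + 3)"
proof -
  define \<eta> where "\<eta> = e / (2 * d)"
  define S where "S = (\<Sum>i<d. est_loss \<tau> i h)"
  define x where "x = est_loss \<tau> f h"
  have d: "real d \<ge> 1" using d_ge_1 by simp
  have e: "0 < e" "e \<le> 1 / 2" using rate_pos rate_le[of \<tau>] by (auto simp: e_def)
  have \<eta>: "\<eta> > 0" using e d by (simp add: \<eta>_def)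
  have x: "x \<ge> 0" and S: "S \<ge> 0"
    using est_loss_nonneg[OF h] f by (auto simp: x_def S_def intro!: sum_nonneg)
  have "- \<eta> * x = ln (exp (- \<eta> * x))" by simp
  also have "\<dots> \<le> ln (\<Sum>j<d. exp (- \<eta> * est_loss \<tau> j h))"
    unfolding x_def using f member_le_sum[of f "{..<d}" "\<lambda>j. exp (- \<eta> * est_loss \<tau> j h)"]
    by (subst ln_le_cancel_iff) (auto intro!: sum_pos)
  also have "\<dots> \<le> ln d - \<eta> * (1 - e) * (player_loss \<tau> h - \<eta> * S) + \<eta>\<^sup>2 / 2 * S"
    using potential_bound[OF h, of \<tau>] by (simp add: S_def \<eta>_def e_def)
  finally have "\<eta> * ((1 - e) * player_loss \<tau> h) \<le> \<eta> * (x + ln d / \<eta> + ((1 - e) * \<eta> + \<eta> / 2) * S)"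
    using \<eta> by (simp add: algebra_simps power2_eq_square)
  then have "(1 - e) * player_loss \<tau> h \<le> x + ln d / \<eta> + ((1 - e) * \<eta> + \<eta> / 2) * S"
    using \<eta> by simp
  also have "\<dots> \<le> x + ln d / \<eta> + (3 / 2 * \<eta>) * S"
    using \<eta> S e by (intro add_left_mono mult_right_mono) (auto simp: algebra_simps)
  also have "\<dots> \<le> x + ln d / \<eta> + (3 / 2 * \<eta>) * (d * (x + 2 * d / e * ln (d / e) + d / e))"
  proof -
    have "S \<le> (\<Sum>i<d. x + 2 * d / e * ln (d / e) + d / e)"
      unfolding S_def x_def e_def using f by (intro sum_mono est_loss_spread[OF h]) auto
    then show ?thesis using \<eta> by (intro add_left_mono mult_left_mono) auto
  qed
  also have "\<dots> = x + d / e * (2 * ln d) + 3 / 4 * e * x + d / e * (3 / 2 * (e * ln d) + 3 / 2 * (e * ln (1 / e)) + 3 / 4 * e)"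
  proof -
    have "ln (d / e) = ln d + ln (1 / e)" using e d by (simp add: ln_div)
    then show ?thesis using e d unfolding \<eta>_def by (simp add: field_simps)
  qed
  also have "\<dots> \<le> x + d / e * (2 * ln d) + e * x + d / e * (2 * ln d + 3)"
  proof -
    \<comment> \<open>This keeps the additive term free of a logarithm of
      \<open>1 / e\<close>.\<close>
    have "e * ln (1 / e) \<le> e * (1 / e)"
      using e ln_bound[of "1 / e"] by (intro mult_left_mono) auto
    then have "e * ln (1 / e) \<le> 1" using e by simp
    moreover have "e * ln d \<le> 1 * ln d" using e d by (intro mult_right_mono) auto
    moreover have "0 \<le> ln d" using d by simp
    ultimately have "3 / 2 * (e * ln d) + 3 / 2 * (e * ln (1 / e)) + 3 / 4 * e \<le> 2 * ln d + 3"
      using e by linarith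
    from mult_left_mono[OF this, of "d / e"]
    have "d / e * (3 / 2 * (e * ln d) + 3 / 2 * (e * ln (1 / e)) + 3 / 4 * e)
        \<le> d / e * (2 * ln d + 3)"
      using e by simp
    moreover have "3 / 4 * e * x \<le> e * x" using e x by simp
    ultimately show ?thesis by linarith
  qed
  also have "\<dots> = (1 + e) * x + d / e * (4 * ln d + 3)" by (simp add: algebra_simps add_divide_distrib)
  finally show ?thesis by (simp add: x_def)
qed

end

text \<open>Converts a bound of the regret by the learner's own loss \<open>x\<close> into one by the best loss \<open>l\<close>
  (both in units of \<open>d ln (d / \<delta>)\<close>, which keeps the hidden factor free of \<open>\<delta>\<close>).\<close>

lemma self_bounding_inequality:
  fixes K :: real
  assumes "K \<ge> 1"
  obtains K' where "K' > 0"
    "\<And>x l Z::real. \<lbrakk>0 \<le> x; 0 \<le> l; 0 \<le> Z; x \<le> l + K * (1 + Z + ln (1 + sqrt x)) * (1 + sqrt x)\<rbrakk>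
      \<Longrightarrow> K * (1 + Z + ln (1 + sqrt x)) * (1 + sqrt x) \<le> K' * (1 + Z)\<^sup>2 * ln (3 + l) * (1 + sqrt l)"
proof
  \<comment> \<open>20 comes from solving the quadratic inequality for \<open>u\<close>, and 2 from
    its term \<open>2 * sqrt (1 + l)\<close>.\<close>
  define A where "A = 22 * K\<^sup>2"
  have K2: "K \<le> K\<^sup>2" "1 \<le> K\<^sup>2" using assms by (auto simp: power2_eq_square mult_ge1_I)
  then have A: "A \<ge> 1" by (simp add: A_def)
  then have lnA: "ln A \<ge> 0" by simp
  \<comment> \<open>The witness for \<open>K'\<close>: the factor \<open>A\<close> comes from the
    bound on \<open>u\<close>, and \<open>4 + ln A\<close> from the bound on
    \<open>1 + Z + ln u\<close>.\<close>
  show "K * (4 + ln A) * A > 0" using assms A lnA by (intro mult_pos_pos) (auto simp: add_pos_nonneg)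
  fix x l Z :: real
  assume nn: "0 \<le> x" "0 \<le> l" "0 \<le> Z" and x: "x \<le> l + K * (1 + Z + ln (1 + sqrt x)) * (1 + sqrt x)"
  define u where "u = 1 + sqrt x"
  have u: "u \<ge> 1" using nn by (simp add: u_def)
  have "u\<^sup>2 \<le> 2 + 2 * x"
  proof -
    have "0 \<le> (1 - sqrt x)\<^sup>2" by simp
    then show ?thesis using nn by (simp add: u_def power2_sum power2_diff)
  qed
  also have "\<dots> \<le> 2 + 2 * l + 2 * K * (1 + Z + 2 * sqrt u) * u"
  proof -
    have "ln u \<le> 2 * sqrt u"
    proof -
      have "ln u = 2 * ln (sqrt u)" using u by (simp add: ln_sqrt)
      also have "\<dots> \<le> 2 * sqrt u" using u ln_bound[of "sqrt u"] by simp
      finally show ?thesis .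
    qed
    then have "K * (1 + Z + ln u) * u \<le> K * (1 + Z + 2 * sqrt u) * u"
      using assms u by (intro mult_right_mono mult_left_mono) auto
    then show ?thesis using x unfolding u_def by linarith
  qed
  also have "\<dots> \<le> 2 + 2 * l + 2 * K * (1 + Z) * u + (u\<^sup>2 / 2 + 8 * K\<^sup>2 * u)"
  proof -
    \<comment> \<open>Half of the square of \<open>u\<close> absorbs the cross term
      \<open>4 * K * sqrt u * u\<close>.\<close>
    have "0 \<le> u / 2 * (sqrt u - 4 * K)\<^sup>2" using u by simp
    also have "\<dots> = u\<^sup>2 / 2 + 8 * K\<^sup>2 * u - 4 * K * sqrt u * u"
      using u by (simp add: power2_diff power2_eq_square algebra_simps)
    finally show ?thesis by (simp add: algebra_simps)
  qed
  finally have "u\<^sup>2 / 2 \<le> 2 + 2 * l + (2 * K * (1 + Z) + 8 * K\<^sup>2) * u" by (simp add: algebra_simps)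
  moreover have "2 * K * (1 + Z) + 8 * K\<^sup>2 \<le> 10 * K\<^sup>2 * (1 + Z)"
  proof -
    have "2 * K * (1 + Z) \<le> 2 * K\<^sup>2 * (1 + Z)" using K2 nn by (intro mult_right_mono) auto
    moreover have "8 * K\<^sup>2 * 1 \<le> 8 * K\<^sup>2 * (1 + Z)" using nn by (intro mult_left_mono) auto
    ultimately show ?thesis by (simp add: algebra_simps)
  qed
  then have "(2 * K * (1 + Z) + 8 * K\<^sup>2) * u \<le> (10 * K\<^sup>2 * (1 + Z)) * u"
    using u by (intro mult_right_mono) auto
  ultimately have quad: "u\<^sup>2 \<le> 4 * (1 + l) + 20 * K\<^sup>2 * (1 + Z) * u" by (simp add: algebra_simps)
  define B where "B = 20 * K\<^sup>2 * (1 + Z)"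
  have B: "B \<ge> 0" using nn by (simp add: B_def)
  \<comment> \<open>Solves \<open>quad\<close>: for a larger \<open>u\<close>, its square would
    exceed \<open>B * u + 4 * (1 + l)\<close>.\<close>
  have "u \<le> B + 2 * sqrt (1 + l)"
  proof (rule ccontr)
    assume "\<not> ?thesis"
    then have *: "u > B + 2 * sqrt (1 + l)" by simp
    then have "u\<^sup>2 > (B + 2 * sqrt (1 + l)) * u"
      using u by (simp add: power2_eq_square)
    moreover have "2 * sqrt (1 + l) * u \<ge> 2 * sqrt (1 + l) * (2 * sqrt (1 + l))"
      using * B nn by (intro mult_left_mono) auto
    ultimately show False using quad nn by (simp add: B_def algebra_simps)
  qed
  also have "\<dots> \<le> B + 2 * (1 + sqrt l)"
    using sqrt_add_le_add_sqrt[of 1 l] nn by simp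
  also have "\<dots> \<le> B * (1 + sqrt l) + 2 * K\<^sup>2 * (1 + Z) * (1 + sqrt l)"
  proof (rule add_mono)
    show "B \<le> B * (1 + sqrt l)" using B nn by (simp add: algebra_simps)
    have "1 * 1 \<le> K\<^sup>2 * (1 + Z)" using K2 nn by (intro mult_mono) auto
    then show "2 * (1 + sqrt l) \<le> 2 * K\<^sup>2 * (1 + Z) * (1 + sqrt l)"
      using nn by (intro mult_right_mono) auto
  qed
  also have "\<dots> = A * (1 + Z) * (1 + sqrt l)" by (simp add: A_def B_def algebra_simps)
  finally have uA: "u \<le> A * (1 + Z) * (1 + sqrt l)" .
  have L: "ln (3 + l) \<ge> 1"
    using nn exp_le by (subst ln_ge_iff) auto
  have "ln u \<le> ln (A * (1 + Z) * (1 + sqrt l))"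
    using uA u by (subst ln_le_cancel_iff) auto
  also have "\<dots> = ln A + ln (1 + Z) + ln (1 + sqrt l)"
    using A nn by (simp add: ln_mult_pos add_pos_nonneg)
  also have "\<dots> \<le> ln A + Z + ln (3 + l)"
  proof -
    have "sqrt l \<le> 1 + l" using nn by (intro real_le_lsqrt) (auto simp: power2_eq_square algebra_simps)
    then have "ln (1 + sqrt l) \<le> ln (3 + l)" using nn by (subst ln_le_cancel_iff) (auto simp: add_pos_nonneg)
    then show ?thesis using ln_add_one_self_le_self[of Z] nn by simp
  qed
  finally have "1 + Z + ln u \<le> 1 + 2 * Z + ln A + ln (3 + l)" by simp
  also have "\<dots> \<le> (4 + ln A) * (1 + Z) * ln (3 + l)"
  proof -
    have "1 + 2 * Z + ln A \<le> (3 + ln A) * (1 + Z)"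
      using lnA nn by (simp add: algebra_simps)
    also have "\<dots> \<le> (3 + ln A) * (1 + Z) * ln (3 + l)"
      using L lnA nn mult_left_mono[OF L, of "(3 + ln A) * (1 + Z)"] by simp
    finally have "1 + 2 * Z + ln A \<le> (3 + ln A) * (1 + Z) * ln (3 + l)" .
    moreover have "ln (3 + l) \<le> (1 + Z) * ln (3 + l)" using L nn by (simp add: algebra_simps)
    ultimately show ?thesis by (simp add: algebra_simps)
  qed
  finally have *: "1 + Z + ln u \<le> (4 + ln A) * (1 + Z) * ln (3 + l)" .
  have "(1 + Z + ln u) * u \<le> ((4 + ln A) * (1 + Z) * ln (3 + l)) * (A * (1 + Z) * (1 + sqrt l))"
    using * uA u nn lnA L by (intro mult_mono) auto
  from mult_left_mono[OF this, of K]
  show "K * (1 + Z + ln (1 + sqrt x)) * (1 + sqrt x)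
      \<le> K * (4 + ln A) * A * (1 + Z)\<^sup>2 * ln (3 + l) * (1 + sqrt l)"
    using assms unfolding u_def by (simp add: power2_eq_square mult_ac)
qed

section \<open>From the deviation of the estimates to the total regret\<close>

context green_ix begin

text \<open>The factor \<open>rate \<tau> / d\<close> is twice the exploration parameter, the scale
  at which the exponential of the estimation error is a supermartingale.\<close>

definition deviation :: "nat \<Rightarrow> nat \<Rightarrow> history \<Rightarrow> real" where
  "deviation \<tau> f h = rate \<tau> / d * (est_loss \<tau> f h - arm_loss \<tau> f h)"

text \<open>Replacing the estimate in \<open>phase_loss_estimate\<close> by the true loss of the arm
  costs a multiple of \<open>d / e * \<Lambda>\<close>; the remaining \<open>e * A\<close> is traded
  for \<open>e * P\<close>, and \<open>2 * e\<close> is \<open>phase_eps c \<tau>\<close>.\<close>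

lemma phase_regret:
  assumes h: "feasible h" and f: "f < d" and dev: "deviation \<tau> f h \<le> \<Lambda>" and "0 \<le> \<Lambda>"
  shows "player_loss \<tau> h - arm_loss \<tau> f h
     \<le> phase_eps c \<tau> * player_loss \<tau> h + 2 * d / phase_eps c \<tau> * (2 * \<Lambda> + 4 * ln d + 3)"
proof -
  define e where "e = rate \<tau>"
  define P where "P = player_loss \<tau> h"
  define A where "A = arm_loss \<tau> f h"
  have e: "0 < e" "e \<le> 1 / 2" using rate_pos rate_le[of \<tau>] by (auto simp: e_def)
  have d: "real d \<ge> 1" using d_ge_1 by simp
  have P: "P \<ge> 0" using player_loss_nonneg[OF h] by (simp add: P_def)
  have "est_loss \<tau> f h \<le> A + d / e * \<Lambda>"
    using dev e d unfolding deviation_def e_def[symmetric] A_def by (simp add: field_simps)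
  then have "(1 + e) * est_loss \<tau> f h \<le> (1 + e) * (A + d / e * \<Lambda>)"
    using e by (intro mult_left_mono) auto
  also have "\<dots> = (1 + e) * A + (1 + e) * (d / e * \<Lambda>)" by (simp add: algebra_simps)
  also have "(1 + e) * (d / e * \<Lambda>) \<le> 2 * (d / e * \<Lambda>)"
    using e assms(4) by (intro mult_right_mono) auto
  finally have "(1 - e) * P \<le> (1 + e) * A + 2 * (d / e * \<Lambda>) + d / e * (4 * ln d + 3)"
    using phase_loss_estimate[OF h f, of \<tau>] by (simp add: P_def e_def)
  then have main: "P - A \<le> e * P + e * A + d / e * (2 * \<Lambda> + 4 * ln d + 3)"
    by (simp add: algebra_simps)
  have X: "0 \<le> d / e * (2 * \<Lambda> + 4 * ln d + 3)"
    using e d assms(4) by (intro mult_nonneg_nonneg) auto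
  have "P - A \<le> 2 * e * P + d / e * (2 * \<Lambda> + 4 * ln d + 3)"
  \<comment> \<open>If the arm lost more than the learner, the left side is negative and the right
    side is not.\<close>
  proof (cases "A \<le> P")
    case True
    then have "e * A \<le> e * P" using e by (intro mult_left_mono) auto
    then show ?thesis using main by linarith
  next
    case False
    moreover have "0 \<le> 2 * e * P" using e P by simp
    ultimately show ?thesis using X by linarith
  qed
  then show ?thesis by (simp add: P_def A_def e_def rate_def mult_ac)
qed

lemma phase_eps_eq: "phase_eps c \<tau> = 1 / c ^ \<tau>"
  by (simp add: phase_eps_def power_one_over)

text \<open>A finished phase has crossed its threshold, but only in its last round, hence by at most
  1; the current phase has not crossed it.\<close>

lemma phase_player_loss:
  assumes "feasible h"
  shows "phase_eps c \<tau> * player_loss \<tau> h \<le> \<psi> / phase_eps c \<tau> + (if \<tau> < phase h then 1 else 0)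
       \<and> (\<tau> < phase h \<longrightarrow> \<psi> / phase_eps c \<tau> < phase_eps c \<tau> * player_loss \<tau> h)"
  using assms
proof induction
  case Nil
  have "\<psi> / phase_eps c \<tau> \<ge> 0" using psi_pos c_gt_1 by (simp add: phase_eps_def)
  then show ?case by (simp add: player_loss_def)
next
  case (snoc h l I)
  obtain k L p where st: "state h = (k, L, p)" by (cases "state h")
  have L: "L = player_loss k h" using state_invariant(1)[of h] st by simp
  have eps: "0 < phase_eps c k" "phase_eps c k \<le> 1"
    using rate_pos[of k] rate_le[of k] by (auto simp: rate_def)
  have "phase_eps c k * l I \<le> 1"
    using eps snoc.hyps by (intro mult_le_one) auto
  then show ?case
    using snoc.IH L st by (cases "\<tau> = k") (auto simp: state_snoc player_loss_snoc fresh_state_def algebra_simps)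
qed

text \<open>By the stopping test, the scaled loss of the learner in a phase is of the order of its
  threshold. So both terms of \<open>phase_regret\<close> are of order \<open>c ^ \<tau>\<close>,
  and the geometric sum is dominated by the current phase.\<close>

lemma total_regret:
  fixes \<Lambda> :: real
  assumes h: "feasible h" and f: "f < d" and "0 \<le> \<Lambda>"
    and dev: "\<And>\<tau>. \<tau> \<le> phase h \<Longrightarrow> deviation \<tau> f h \<le> \<Lambda> + (real \<tau> + 1) * ln 2"
  shows "(\<Sum>(I, l)\<leftarrow>h. l I) - (\<Sum>(I, l)\<leftarrow>h. l f)
     \<le> (\<psi> + 1 + 2 * d * (2 * \<Lambda> + 2 * (phase h + 1) + 4 * ln d + 3)) * (c / (c - 1)) * c ^ phase h"
proof -
  define N where "N = phase h"
  define X where "X = \<psi> + 1 + 2 * d * (2 * \<Lambda> + 2 * (N + 1) + 4 * ln d + 3)"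
  have d: "real d \<ge> 1" using d_ge_1 by simp
  have X: "X \<ge> 0" using psi_pos d assms(3) by (simp add: X_def)
  have each: "player_loss \<tau> h - arm_loss \<tau> f h \<le> X * c ^ \<tau>" if "\<tau> \<le> N" for \<tau>
  proof -
    define \<epsilon> where "\<epsilon> = phase_eps c \<tau>"
    have eps: "0 < \<epsilon>" "\<epsilon> \<le> 1"
      using rate_pos[of \<tau>] rate_le[of \<tau>] by (auto simp: rate_def \<epsilon>_def)
    have ceps: "c ^ \<tau> = 1 / \<epsilon>" by (simp add: \<epsilon>_def phase_eps_eq)
    \<comment> \<open>The allowance of each phase is replaced by a bound for the last one.\<close>
    have "(real \<tau> + 1) * ln 2 \<le> (real N + 1) * 1"
      using that ln_2_less_1 by (intro mult_mono) auto
    then have "deviation \<tau> f h \<le> \<Lambda> + (real N + 1)"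
      using dev[of \<tau>] that by (simp add: N_def)
    then have "player_loss \<tau> h - arm_loss \<tau> f h
        \<le> \<epsilon> * player_loss \<tau> h + 2 * d / \<epsilon> * (2 * (\<Lambda> + (real N + 1)) + 4 * ln d + 3)"
      using phase_regret[OF h f, of \<tau> "\<Lambda> + (real N + 1)"] assms(3) by (simp add: \<epsilon>_def)
    also have "\<epsilon> * player_loss \<tau> h \<le> \<psi> / \<epsilon> + 1 / \<epsilon>"
    proof -
      have "\<epsilon> * player_loss \<tau> h \<le> \<psi> / \<epsilon> + 1"
        using phase_player_loss[OF h, of \<tau>] by (auto simp: \<epsilon>_def split: if_splits)
      also have "1 \<le> 1 / \<epsilon>" using eps by simp
      finally show ?thesis by simp
    qed
    finally show ?thesis by (simp add: X_def ceps algebra_simps add_divide_distrib)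
  qed
  have "(\<Sum>(I, l)\<leftarrow>h. l I) - (\<Sum>(I, l)\<leftarrow>h. l f) = (\<Sum>\<tau>\<le>N. player_loss \<tau> h - arm_loss \<tau> f h)"
    using sum_phases[of h N "\<lambda>(I, l). l I"] sum_phases[of h N "\<lambda>(I, l). l f"]
    by (simp add: N_def player_loss_def arm_loss_def sum_subtractf)
  also have "\<dots> \<le> (\<Sum>\<tau>\<le>N. X * c ^ \<tau>)" using each by (intro sum_mono) auto
  also have "\<dots> = X * (\<Sum>\<tau>\<le>N. c ^ \<tau>)" by (simp add: sum_distrib_left)
  also have "\<dots> \<le> X * (c / (c - 1) * c ^ N)"
  proof (intro mult_left_mono X)
    have "(\<Sum>\<tau>\<le>N. c ^ \<tau>) = (c ^ Suc N - 1) / (c - 1)"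
      using c_gt_1 geometric_sum[of c "Suc N"] by (simp add: lessThan_Suc_atMost)
    also have "\<dots> \<le> c ^ Suc N / (c - 1)" using c_gt_1 by (intro divide_right_mono) auto
    finally show "(\<Sum>\<tau>\<le>N. c ^ \<tau>) \<le> c / (c - 1) * c ^ N" by simp
  qed
  finally show ?thesis by (simp add: X_def N_def mult.assoc)
qed

text \<open>The threshold of the last finished phase \<open>M\<close> forces a loss above
  \<open>\<psi> * (c ^ M)\<^sup>2\<close> in it, which the total loss dominates. The additive 1
  covers a run still in its first phase.\<close>

lemma phase_count_bound:
  assumes h: "feasible h"
  shows "c ^ phase h \<le> 1 + c * sqrt ((\<Sum>(I, l)\<leftarrow>h. l I) / \<psi>)"
proof (cases "phase h")
  case 0
  have "0 \<le> (\<Sum>\<tau>\<le>phase h. player_loss \<tau> h)"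
    by (intro sum_nonneg player_loss_nonneg[OF h])
  also have "\<dots> = (\<Sum>(I, l)\<leftarrow>h. l I)"
    unfolding player_loss_def using sum_phases[of h "phase h" "\<lambda>(I, l). l I"] by simp
  finally show ?thesis using psi_pos c_gt_1 by (simp add: 0)
next
  case (Suc M)
  have "\<psi> / phase_eps c M < phase_eps c M * player_loss M h"
    using phase_player_loss[OF h, of M] Suc by simp
  then have "(c ^ M)\<^sup>2 < player_loss M h / \<psi>"
    using psi_pos c_gt_1 by (simp add: phase_eps_eq field_simps power2_eq_square)
  also have "player_loss M h \<le> (\<Sum>\<tau>\<le>phase h. player_loss \<tau> h)"
    using Suc by (intro member_le_sum player_loss_nonneg[OF h]) auto
  also have "\<dots> = (\<Sum>(I, l)\<leftarrow>h. l I)"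
    unfolding player_loss_def using sum_phases[of h "phase h" "\<lambda>(I, l). l I"] by simp
  finally have "(c ^ M)\<^sup>2 \<le> (\<Sum>(I, l)\<leftarrow>h. l I) / \<psi>"
    using psi_pos by (simp add: divide_right_mono)
  then have "c ^ M \<le> sqrt ((\<Sum>(I, l)\<leftarrow>h. l I) / \<psi>)" by (rule real_le_rsqrt)
  then have "c * c ^ M \<le> c * sqrt ((\<Sum>(I, l)\<leftarrow>h. l I) / \<psi>)" using c_gt_1 by (intro mult_left_mono) auto
  then show ?thesis by (simp add: Suc)
qed

end

section \<open>Regret against the best arm and its pathwise bound\<close>

lemma regret_le_total:
  assumes "d \<ge> 1"
  shows "regret d h \<le> (\<Sum>(I, l)\<leftarrow>h. l I) - best_loss d h"
proof -
  have split: "(\<Sum>(I, l)\<leftarrow>h. l I - l f) = (\<Sum>(I, l)\<leftarrow>h. l I) - (\<Sum>(I, l)\<leftarrow>h. l f)" for f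
    by (induction h) auto
  have "(\<Sum>(I, l)\<leftarrow>h. l I - l f) \<le> (\<Sum>(I, l)\<leftarrow>h. l I) - best_loss d h" if "f < d" for f
  proof -
    have "best_loss d h \<le> (\<Sum>(I, l)\<leftarrow>h. l f)"
      unfolding best_loss_def using that by (intro Min_le) auto
    then show ?thesis by (simp add: split)
  qed
  then show ?thesis
    unfolding regret_def using assms by (subst Max_le_iff) (auto simp: lessThan_empty_iff)
qed

lemma best_loss_attained:
  assumes "d \<ge> 1"
  obtains f where "f < d" "best_loss d h = (\<Sum>(I, l)\<leftarrow>h. l f)"
proof -
  have "best_loss d h \<in> (\<lambda>f. \<Sum>(I, l)\<leftarrow>h. l f) ` {..<d}"
    unfolding best_loss_def using assms by (intro Min_in) (auto simp: lessThan_empty_iff)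
  then show ?thesis using that by auto
qed

context green_ix begin

lemma feasible_loss_bounds:
  assumes "feasible h" "f < d"
  shows "0 \<le> (\<Sum>(I, l)\<leftarrow>h. l f)" "(\<Sum>(I, l)\<leftarrow>h. l f) \<le> length h"
    "0 \<le> (\<Sum>(I, l)\<leftarrow>h. l I)" "(\<Sum>(I, l)\<leftarrow>h. l I) \<le> length h"
  using assms(1)
proof (induction)
  case (snoc h l I)
  { case 1 show ?case using snoc assms(2) by auto next
    case 2 show ?case using snoc assms(2) by fastforce next
    case 3 show ?case using snoc by auto next
    case 4 show ?case using snoc by fastforce }
qed auto

lemma best_loss_bounds:
  assumes "feasible h"
  shows "0 \<le> best_loss d h" "best_loss d h \<le> length h"
  using best_loss_attained[OF d_ge_1, of h] feasible_loss_bounds[OF assms] by metis+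

lemma regret_bounds:
  assumes "feasible h"
  shows "\<bar>regret d h\<bar> \<le> length h"
proof -
  have d: "0 < d" using d_ge_1 by simp
  have "(\<Sum>(I, l)\<leftarrow>h. l I - l 0) \<le> regret d h"
    unfolding regret_def using d by (intro Max_ge) auto
  moreover have "(\<Sum>(I, l)\<leftarrow>h. l I - l 0) = (\<Sum>(I, l)\<leftarrow>h. l I) - (\<Sum>(I, l)\<leftarrow>h. l 0)"
    by (induction h) auto
  ultimately show ?thesis
    using regret_le_total[OF d_ge_1, of h] feasible_loss_bounds[OF assms d] best_loss_bounds[OF assms] by linarith
qed

end

text \<open>Shared by both regret bounds, with a constant that depends on \<open>a\<close>,
  \<open>b\<close> and \<open>c\<close> only. \<open>D\<close> is the scale of
  \<open>\<psi>\<close>, and \<open>Z\<close> measures the excess of the deviation level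
  \<open>\<Lambda>\<close> over \<open>D / d\<close>; it is zero for the high-probability bound and
  random for the expectation.\<close>

lemma regret_pathwise:
  fixes a b c :: real
  assumes "0 < a" "0 < b" "1 < c"
  obtains K where "K > 0"
    "\<And>d \<psi> D \<Lambda> Z h. \<lbrakk>d \<ge> 2; a * D \<le> \<psi>; \<psi> \<le> b * D; d * ln d \<le> D; 0 \<le> \<Lambda>; d * \<Lambda> \<le> D * (1 + Z); 0 \<le> Z;
       green_ix.feasible d c \<psi> h;
       \<And>\<tau> f. \<tau> \<le> length h \<Longrightarrow> f < d \<Longrightarrow> green_ix.deviation d c \<psi> \<tau> f h \<le> \<Lambda> + (real \<tau> + 1) * ln 2\<rbrakk>
      \<Longrightarrow> regret d h \<le> K * (1 + Z)\<^sup>2 * ln (3 + best_loss d h) * (sqrt (D * best_loss d h) + D)"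
proof -
  \<comment> \<open>Factor in \<open>c ^ N \<le> K2 * u\<close>: 1 is the additive term of
    \<open>phase_count_bound\<close>, and \<open>c / sqrt a\<close> comes from
    \<open>a * D \<le> \<psi>\<close>.\<close>
  define K2 where "K2 = 1 + c / sqrt a"
  have K2: "K2 \<ge> 1" using assms by (simp add: K2_def)
  \<comment> \<open>Bounds the bracket of \<open>total_regret\<close> in units of
    \<open>D * W\<close>: \<open>b\<close> accounts for \<open>\<psi>\<close>, 41 for
    \<open>33 + 4 * Z\<close>, and the last summand for \<open>8 * real N\<close>.\<close>
  define B where "B = b + 41 + 8 * (ln K2 + 1) / ln c"
  have lnc: "ln c > 0" using assms by simp
  have lnK2: "ln K2 \<ge> 0" using K2 by simp
  have B: "B \<ge> 41" using assms lnK2 lnc by (simp add: B_def)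
  define K where "K = B * K2 * (c / (c - 1))"
  have "1 * 1 * 1 \<le> K"
    unfolding K_def using B K2 assms by (intro mult_mono) auto
  then have K: "K \<ge> 1" by simp
  obtain K' where K': "K' > 0"
    "\<And>x l Z::real. \<lbrakk>0 \<le> x; 0 \<le> l; 0 \<le> Z; x \<le> l + K * (1 + Z + ln (1 + sqrt x)) * (1 + sqrt x)\<rbrakk>
      \<Longrightarrow> K * (1 + Z + ln (1 + sqrt x)) * (1 + sqrt x) \<le> K' * (1 + Z)\<^sup>2 * ln (3 + l) * (1 + sqrt l)"
    using self_bounding_inequality[OF K] by blast
  show thesis
  proof (rule that[OF K'(1)])
    fix d :: nat and \<psi> D \<Lambda> Z :: real and h :: history
    assume d: "d \<ge> 2" and psi: "a * D \<le> \<psi>" "\<psi> \<le> b * D" and D: "d * ln d \<le> D"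
      and \<Lambda>: "0 \<le> \<Lambda>" "d * \<Lambda> \<le> D * (1 + Z)" and Z: "0 \<le> Z" and h: "green_ix.feasible d c \<psi> h"
      and dev: "\<And>\<tau> f. \<tau> \<le> length h \<Longrightarrow> f < d \<Longrightarrow> green_ix.deviation d c \<psi> \<tau> f h \<le> \<Lambda> + (real \<tau> + 1) * ln 2"
    \<comment> \<open>With two or more arms \<open>ln d\<close> exceeds 1/2, which yields
      \<open>d \<le> 2 * D\<close> and \<open>D \<ge> 1\<close>.\<close>
    have "d * (1 / 2) \<le> d * ln d"
    proof (intro mult_left_mono)
      have "(1::real) / 2 \<le> ln 2" using ln2_ge_two_thirds by simp
      also have "\<dots> \<le> ln d" using d by (subst ln_le_cancel_iff) auto
      finally show "1 / 2 \<le> ln (real d)" .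
    qed auto
    then have dD: "d \<le> 2 * D" using D by simp
    have D1: "D \<ge> 1" using dD d by linarith
    interpret green_ix d c \<psi>
      using d assms psi D1 by unfold_locales (auto intro: less_le_trans[of 0 "a * D"])
    obtain f where f: "f < d" "best_loss d h = (\<Sum>(I, l)\<leftarrow>h. l f)"
      using best_loss_attained[OF d_ge_1] by blast
    define N where "N = phase h"
    define Lh where "Lh = (\<Sum>(I, l)\<leftarrow>h. l I)"
    define x where "x = Lh / D"
    define l where "l = best_loss d h / D"
    define u where "u = 1 + sqrt x"
    have Lh: "Lh \<ge> 0" unfolding Lh_def using feasible_loss_bounds[OF h f(1)] by simp
    have x: "x \<ge> 0" using Lh D1 by (simp add: x_def)
    have bl: "best_loss d h \<ge> 0" by (rule best_loss_bounds[OF h])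
    have l: "0 \<le> l" "l \<le> best_loss d h"
      using bl D1 mult_left_mono[OF D1 bl] by (auto simp: l_def divide_le_eq)
    have u: "u \<ge> 1" using x by (simp add: u_def)
    have cN: "c ^ N \<le> K2 * u"
    proof -
      have "c ^ N \<le> 1 + c * sqrt (Lh / \<psi>)"
        using phase_count_bound[OF h] by (simp add: N_def Lh_def)
      also have "sqrt (Lh / \<psi>) \<le> sqrt (Lh / (a * D))"
        using psi Lh assms D1 by (intro real_sqrt_le_mono divide_left_mono) (auto intro!: mult_pos_pos psi_pos)
      also have "\<dots> = sqrt x / sqrt a" by (simp add: x_def real_sqrt_divide real_sqrt_mult)
      also have "1 + c * (sqrt x / sqrt a) \<le> K2 * u"
        using x assms by (simp add: K2_def u_def algebra_simps add_divide_distrib)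
      finally show ?thesis using assms by simp
    qed
    \<comment> \<open>The number of phases is logarithmic in the learner's loss, so the allowance of
      \<open>ln 2\<close> per phase costs only a logarithm.\<close>
    have N: "real N \<le> (ln K2 + ln u) / ln c"
    proof -
      have "real N * ln c = ln (c ^ N)" using assms by (simp add: ln_realpow)
      also have "\<dots> \<le> ln (K2 * u)" using cN K2 u assms by (subst ln_le_cancel_iff) auto
      also have "\<dots> = ln K2 + ln u" using K2 u by (simp add: ln_mult_pos)
      finally show ?thesis using lnc by (simp add: field_simps)
    qed
    have lnu: "ln u \<ge> 0" using u by simp
    define W where "W = 1 + Z + ln u"
    have W: "W \<ge> 1" using Z lnu by (simp add: W_def)
    have "\<psi> + 1 + 2 * d * (2 * \<Lambda> + 2 * (N + 1) + 4 * ln d + 3)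
        = \<psi> + 1 + 4 * (d * \<Lambda>) + d * (4 * real N + 10) + 8 * (d * ln d)"
      by (simp add: algebra_simps)
    also have "\<dots> \<le> b * D + D + 4 * (D * (1 + Z)) + 2 * D * (4 * real N + 10) + 8 * D"
      using psi D \<Lambda> D1 by (intro add_mono mult_right_mono dD mult_left_mono) auto
    also have "\<dots> = D * (b + 33 + 4 * Z + 8 * real N)" by (simp add: algebra_simps)
    also have "\<dots> \<le> D * (B * W)"
    proof (rule mult_left_mono)
      have "8 * real N \<le> 8 * (ln K2 + ln u) / ln c" using mult_left_mono[OF N, of 8] by simp
      also have "\<dots> \<le> 8 * (ln K2 + 1) / ln c * W"
      proof -
        have "ln K2 + ln u \<le> (ln K2 + 1) * W"
        proof -
          have "ln K2 * 1 \<le> ln K2 * W" using lnK2 W by (intro mult_left_mono)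
          then show ?thesis using Z by (simp add: algebra_simps) (simp add: W_def)
        qed
        from divide_right_mono[OF mult_left_mono[OF this, of 8], of "ln c"]
        show ?thesis using lnc by (simp add: algebra_simps)
      qed
      finally have "8 * real N \<le> 8 * (ln K2 + 1) / ln c * W" .
      moreover have "b * 1 \<le> b * W" using W assms by (intro mult_left_mono) auto
      moreover have "33 + 4 * Z \<le> 41 * W" using Z lnu by (simp add: W_def)
      ultimately show "b + 33 + 4 * Z + 8 * real N \<le> B * W" by (simp add: B_def distrib_right)
    qed (use D1 in simp)
    finally have X: "\<psi> + 1 + 2 * d * (2 * \<Lambda> + 2 * (N + 1) + 4 * ln d + 3) \<le> D * (B * W)" .
    have "Lh - best_loss d h \<le> (\<psi> + 1 + 2 * d * (2 * \<Lambda> + 2 * (N + 1) + 4 * ln d + 3)) * (c / (c - 1)) * c ^ N"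
      unfolding Lh_def f(2) N_def
      using total_regret[OF h f(1) \<Lambda>(1)] dev[OF order_trans[OF _ phase_le_length] f(1)] by simp
    also have "\<dots> \<le> (D * (B * W)) * (c / (c - 1)) * (K2 * u)"
      using X cN D1 B W assms by (intro mult_mono) auto
    also have "\<dots> = D * (K * W * u)" by (simp add: K_def)
    finally have main: "Lh - best_loss d h \<le> D * (K * W * u)" .
    \<comment> \<open>The learner's loss in units of \<open>D\<close> occurs on both sides, as
      \<open>u = 1 + sqrt x\<close>; this is what \<open>self_bounding_inequality\<close>
      resolves.\<close>
    have "x \<le> l + K * W * u"
    proof -
      have "x - l = (Lh - best_loss d h) / D" by (simp add: x_def l_def diff_divide_distrib)
      also have "\<dots> \<le> K * W * u" using main D1 by (simp add: divide_le_eq mult.commute)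
      finally show ?thesis by simp
    qed
    then have "K * W * u \<le> K' * (1 + Z)\<^sup>2 * ln (3 + l) * (1 + sqrt l)"
      using K'(2)[OF x l(1) Z] by (simp add: W_def u_def)
    also have "\<dots> \<le> K' * (1 + Z)\<^sup>2 * ln (3 + best_loss d h) * (1 + sqrt l)"
      using K'(1) l by (intro mult_right_mono mult_left_mono) auto
    finally have "D * (K * W * u) \<le> D * (K' * (1 + Z)\<^sup>2 * ln (3 + best_loss d h) * (1 + sqrt l))"
      using D1 by (intro mult_left_mono) auto
    also have "\<dots> = K' * (1 + Z)\<^sup>2 * ln (3 + best_loss d h) * (sqrt (D * best_loss d h) + D)"
    proof -
      have "D * sqrt l = sqrt (D\<^sup>2 * l)" using D1 by (simp add: real_sqrt_mult)
      also have "D\<^sup>2 * l = D * best_loss d h" using D1 by (simp add: l_def power2_eq_square)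
      finally have "D * (1 + sqrt l) = sqrt (D * best_loss d h) + D" by (simp add: distrib_left)
      then show ?thesis by (metis mult.assoc mult.commute)
    qed
    finally show "regret d h \<le> K' * (1 + Z)\<^sup>2 * ln (3 + best_loss d h) * (sqrt (D * best_loss d h) + D)"
      using main regret_le_total[OF d_ge_1, of h] by (simp add: Lh_def)
  qed
qed

section \<open>The exponential supermartingale\<close>

context green_ix begin

lemma deviation_snoc:
  "deviation \<tau> f (h @ [(I, l)]) = deviation \<tau> f h +
     (if phase h = \<tau> then rate \<tau> / d * (step_est h I l f - l f) else 0)"
  by (simp add: deviation_def est_loss_snoc arm_loss_snoc algebra_simps)

text \<open>Given the history and the loss vector, the arm is drawn from the learner's weights, so
  \<open>nn_integral_implicit_exploration\<close> applies to each loss vector before averaging over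
  the adversary's choice. Rounds outside phase \<open>\<tau>\<close> leave the exponential
  unchanged.\<close>

lemma nn_integral_exp_deviation:
  assumes adv: "valid_adversary d adv" and f: "f < d"
  shows "(\<integral>\<^sup>+ h. ennreal (exp (deviation \<tau> f h)) \<partial>bandit_run d c \<psi> adv T) \<le> 1"
proof (induction T)
  case 0
  then show ?case by (simp add: deviation_def est_loss_def arm_loss_def)
next
  case (Suc T)
  have step: "(\<integral>\<^sup>+ I. ennreal (exp (deviation \<tau> f (h @ [(I, l)]))) \<partial>learner_draw d c (state h))
      \<le> ennreal (exp (deviation \<tau> f h))" if l: "l \<in> set_pmf (adv h)" for h l
  proof (cases "phase h = \<tau>")
    case False
    then show ?thesis by (simp add: deviation_snoc)
  next
    case True
    have "rate \<tau> / d = 2 * (rate \<tau> / (2 * d))" by simp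
    then have "(\<integral>\<^sup>+ I. ennreal (exp (rate \<tau> / d * (step_est h I l f - l f))) \<partial>learner_draw d c (state h)) \<le> 1"
      using nn_integral_implicit_exploration[OF simplex_arm_dist[of h] rate_pos[of \<tau>], of "rate \<tau> / (2 * d)" l f]
        rate_le[of \<tau>] rate_pos[of \<tau>] l adv f
      by (simp add: learner_draw_state True step_est_def valid_adversary_def)
    then have "ennreal (exp (deviation \<tau> f h)) *
        (\<integral>\<^sup>+ I. ennreal (exp (rate \<tau> / d * (step_est h I l f - l f))) \<partial>learner_draw d c (state h))
        \<le> ennreal (exp (deviation \<tau> f h)) * 1"
      by (intro mult_left_mono) auto
    then show ?thesis
      by (simp add: deviation_snoc True exp_add ennreal_mult nn_integral_cmult)
  qed
  have "(\<integral>\<^sup>+ l. \<integral>\<^sup>+ I. ennreal (exp (deviation \<tau> f (h @ [(I, l)]))) \<partial>learner_draw d c (state h) \<partial>adv h)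
      \<le> (\<integral>\<^sup>+ l. ennreal (exp (deviation \<tau> f h)) \<partial>adv h)" for h
    using step by (intro nn_integral_mono_AE) (auto simp: AE_measure_pmf_iff)
  then have "(\<integral>\<^sup>+ h. ennreal (exp (deviation \<tau> f h)) \<partial>bandit_run d c \<psi> adv (Suc T))
      \<le> (\<integral>\<^sup>+ h. ennreal (exp (deviation \<tau> f h)) \<partial>bandit_run d c \<psi> adv T)"
    by (auto simp: measure_pmf.emeasure_space_1 intro!: nn_integral_mono)
  then show ?case using Suc.IH by (rule order_trans)
qed

text \<open>The weights realize a union bound over arms and phases: the allowance of phase \<open>\<tau>\<close>
  grows with \<open>\<tau>\<close> by \<open>ln 2\<close> per phase, which is affordable since phases lengthen geometrically.\<close>

definition total_deviation :: "nat \<Rightarrow> history \<Rightarrow> real" where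
  "total_deviation T h = (\<Sum>f<d. \<Sum>\<tau>\<le>T. (1 / 2) ^ Suc \<tau> * exp (deviation \<tau> f h))"

lemma total_deviation_nonneg: "0 \<le> total_deviation T h"
  by (auto simp: total_deviation_def intro!: sum_nonneg)

text \<open>A single summand is at most the whole sum; taking logarithms turns its weight into the
  additive allowance of the phase.\<close>

lemma deviation_le:
  assumes "total_deviation T h \<le> exp \<Lambda>" "\<tau> \<le> T" "f < d"
  shows "deviation \<tau> f h \<le> \<Lambda> + (real \<tau> + 1) * ln 2"
proof -
  have "(1 / 2) ^ Suc \<tau> * exp (deviation \<tau> f h) \<le> (\<Sum>\<tau>\<le>T. (1 / 2) ^ Suc \<tau> * exp (deviation \<tau> f h))"
    using assms(2) by (intro member_le_sum) auto
  also have "\<dots> \<le> total_deviation T h"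
    unfolding total_deviation_def using assms(3)
    by (intro member_le_sum[of f "{..<d}" "\<lambda>f. \<Sum>\<tau>\<le>T. (1 / 2) ^ Suc \<tau> * exp (deviation \<tau> f h)"])
       (auto intro!: sum_nonneg)
  also have "\<dots> \<le> exp \<Lambda>" by (rule assms(1))
  finally have "exp (deviation \<tau> f h) \<le> exp \<Lambda> * 2 ^ Suc \<tau>"
    by (simp add: power_one_over field_simps)
  also have "2 ^ Suc \<tau> = exp ((real \<tau> + 1) * ln 2)"
    using exp_of_nat_mult[of "Suc \<tau>" "ln 2::real"] by (simp add: add.commute)
  finally show ?thesis by (simp add: exp_add[symmetric])
qed

text \<open>Each exponential has mean at most 1 and the weights of one arm sum to less than 1, so
  each of the \<open>d\<close> arms contributes at most 1. Finiteness of the nonnegative integral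
  gives integrability.\<close>

lemma
  assumes adv: "valid_adversary d adv"
  shows integrable_total_deviation: "integrable (bandit_run d c \<psi> adv T) (total_deviation T)"
    and expectation_total_deviation:
      "measure_pmf.expectation (bandit_run d c \<psi> adv T) (total_deviation T) \<le> d"
proof -
  let ?M = "measure_pmf (bandit_run d c \<psi> adv T)"
  have "(\<integral>\<^sup>+ h. ennreal (total_deviation T h) \<partial>?M)
      = (\<integral>\<^sup>+ h. (\<Sum>f<d. \<Sum>\<tau>\<le>T. ennreal ((1 / 2) ^ Suc \<tau>) * ennreal (exp (deviation \<tau> f h))) \<partial>?M)"
    by (simp add: total_deviation_def sum_nonneg flip: ennreal_mult)
  also have "\<dots> = (\<Sum>f<d. \<Sum>\<tau>\<le>T. ennreal ((1 / 2) ^ Suc \<tau>) * (\<integral>\<^sup>+ h. ennreal (exp (deviation \<tau> f h)) \<partial>?M))"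
    by (simp add: nn_integral_sum nn_integral_cmult)
  also have "\<dots> \<le> (\<Sum>f<d. \<Sum>\<tau>\<le>T. ennreal ((1 / 2) ^ Suc \<tau>) * 1)"
    using nn_integral_exp_deviation[OF adv] by (intro sum_mono mult_left_mono) auto
  also have "\<dots> = ennreal (\<Sum>f<d. \<Sum>\<tau>\<le>T. (1 / 2) ^ Suc \<tau>)"
    by (simp add: sum_nonneg ennreal_mult ennreal_of_nat_eq_real_of_nat)
  also have "\<dots> \<le> ennreal (\<Sum>f<d. 1)"
  proof (intro ennreal_leI sum_mono)
    have "(\<Sum>\<tau>\<le>T. (1 / 2 :: real) ^ Suc \<tau>) = 1 - (1 / 2) ^ Suc T" by (induction T) auto
    then show "(\<Sum>\<tau>\<le>T. (1 / 2 :: real) ^ Suc \<tau>) \<le> 1" by simp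
  qed
  finally have le: "(\<integral>\<^sup>+ h. ennreal (total_deviation T h) \<partial>?M) \<le> ennreal d" by simp
  show int: "integrable ?M (total_deviation T)"
    using le by (intro integrableI_nonneg) (auto simp: total_deviation_nonneg intro: le_less_trans)
  have "ennreal (measure_pmf.expectation (bandit_run d c \<psi> adv T) (total_deviation T))
      = (\<integral>\<^sup>+ h. ennreal (total_deviation T h) \<partial>?M)"
    using int by (intro nn_integral_eq_integral[symmetric]) (auto simp: total_deviation_nonneg)
  then have "ennreal (measure_pmf.expectation (bandit_run d c \<psi> adv T) (total_deviation T)) \<le> ennreal d"
    using le by simp
  then show "measure_pmf.expectation (bandit_run d c \<psi> adv T) (total_deviation T) \<le> d"
    by (subst (asm) ennreal_le_iff) auto
qed

text \<open>Markov's inequality at level \<open>d / \<delta>\<close>, the mean being at most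
  \<open>d\<close>.\<close>

lemma prob_total_deviation:
  assumes "valid_adversary d adv" "\<delta> > 0"
  shows "measure_pmf.prob (bandit_run d c \<psi> adv T) {h. total_deviation T h \<le> d / \<delta>} \<ge> 1 - \<delta>"
proof -
  let ?M = "measure_pmf (bandit_run d c \<psi> adv T)"
  have d: "real d > 0" using d_ge_1 by simp
  have "measure ?M {h. total_deviation T h > d / \<delta>} \<le> measure ?M {h. total_deviation T h \<ge> d / \<delta>}"
    by (intro measure_pmf.finite_measure_mono) auto
  also have "\<dots> \<le> measure_pmf.expectation (bandit_run d c \<psi> adv T) (total_deviation T) / (d / \<delta>)"
    using integral_Markov_inequality_measure[OF integrable_total_deviation[OF assms(1), of T], of "{}" "d / \<delta>"] d assms(2)
    by (simp add: total_deviation_nonneg)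
  also have "\<dots> \<le> d / (d / \<delta>)"
    using expectation_total_deviation[OF assms(1)] d assms(2) by (intro divide_right_mono) auto
  also have "\<dots> = \<delta>" using d by simp
  finally have "measure ?M {h. total_deviation T h > d / \<delta>} \<le> \<delta>" .
  moreover have "measure ?M {h. total_deviation T h \<le> d / \<delta>} = 1 - measure ?M {h. total_deviation T h > d / \<delta>}"
    by (subst measure_pmf.prob_compl[symmetric]) (auto intro!: arg_cong[where f = "measure ?M"])
  ultimately show ?thesis by simp
qed

text \<open>Treats the case that \<open>regret_pathwise\<close> excludes. The bound on the
  expectation is zero there, since \<open>ln 1 = 0\<close>, so the regret has to vanish
  exactly.\<close>

lemma regret_single_arm:
  assumes "d = 1" "feasible h"
  shows "regret d h = 0"
proof -
  have "(\<Sum>(I, l)\<leftarrow>h. l I - l 0) = 0"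
    using assms(2) by induction (use assms(1) in auto)
  moreover have "{..<d} = {0}" using assms(1) by auto
  ultimately show ?thesis by (simp add: regret_def)
qed

end

section \<open>Regret bounds\<close>

lemma ln_three_plus_ge_1: "0 \<le> x \<Longrightarrow> 1 \<le> ln (3 + x :: real)"
  using exp_le by (subst ln_ge_iff) auto

lemma polylog_ge:
  assumes "0 \<le> L"
  shows "ln (3 + L) ^ k \<le> polylog k d L"
  unfolding polylog_def
  using ln_three_plus_ge_1[of "real d"] ln_three_plus_ge_1[OF assms]
  by (intro power_mono) auto

text \<open>Either \<open>Z\<close> is logarithmic in \<open>L\<close>, or all quantities in \<open>L\<close> are dominated by the exponential
  of \<open>Z\<close>.  So a tail bound for \<open>Z\<close> controls the expectation of the product, although \<open>Z\<close> and
  \<open>L\<close> are dependent.\<close>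

lemma powers_absorbed_by_exp:
  fixes L Z D :: real
  assumes "0 \<le> L" "0 \<le> Z" "1 \<le> D"
  defines "f \<equiv> ln (3 + L) * (sqrt (D * L) + D)"
  shows "(1 + Z)\<^sup>2 * f \<le> 16 * ln (3 + L) ^ 2 * f + 216 * D * exp (Z * ln 2)"
proof (cases "1 + Z \<le> 4 * ln (3 + L)")
  case True
  have f: "0 \<le> f" using assms ln_three_plus_ge_1[of L] by (auto simp: f_def)
  have "(1 + Z)\<^sup>2 \<le> (4 * ln (3 + L))\<^sup>2" using True assms by (intro power_mono) auto
  then have "(1 + Z)\<^sup>2 * f \<le> (4 * ln (3 + L))\<^sup>2 * f" using f by (intro mult_right_mono)
  moreover have "0 \<le> 216 * D * exp (Z * ln 2)" using assms by simp
  ultimately show ?thesis by (simp add: power_mult_distrib)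
next
  case False
  have f: "0 \<le> f" using assms ln_three_plus_ge_1[of L] by (auto simp: f_def)
  \<comment> \<open>Now \<open>3 + L\<close> is at most \<open>exp ((1 + Z) / 4)\<close>, while
    \<open>f\<close> is at most \<open>D\<close> times the square of \<open>3 + L\<close>.\<close>
  have "ln (3 + L) \<le> (1 + Z) / 4" using False by simp
  then have "exp (ln (3 + L)) \<le> exp ((1 + Z) / 4)" by (rule exp_le_cancel_iff[THEN iffD2])
  then have "3 + L \<le> exp ((1 + Z) / 4)" using assms by simp
  have sq: "sqrt L \<le> 1 + L" using assms by (intro real_le_lsqrt) (auto simp: power2_eq_square algebra_simps)
  have "sqrt (D * L) = sqrt D * sqrt L" by (simp add: real_sqrt_mult)
  also have "\<dots> \<le> D * (1 + L)"
    using assms sq real_sqrt_le_mono[of D "D\<^sup>2"] by (intro mult_mono) (auto simp: power2_eq_square)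
  finally have "sqrt (D * L) + D \<le> D * (3 + L)" using assms by (simp add: algebra_simps)
  moreover have "ln (3 + L) \<le> 3 + L" using assms ln_bound[of "3 + L"] by simp
  ultimately have "f \<le> (3 + L) * (D * (3 + L))"
    unfolding f_def using assms by (intro mult_mono) auto
  also have "\<dots> = D * (3 + L)\<^sup>2" by (simp add: power2_eq_square)
  also have "\<dots> \<le> D * (exp ((1 + Z) / 4))\<^sup>2"
    using assms \<open>3 + L \<le> _\<close> by (intro mult_left_mono power_mono) auto
  also have "\<dots> = D * exp ((1 + Z) / 2)" by (simp add: power2_eq_square exp_add[symmetric])
  finally have f_le: "f \<le> D * exp ((1 + Z) / 2)" .
  \<comment> \<open>In the exponent, the square of \<open>1 + Z\<close> costs 1/6 and
    \<open>f\<close> costs 1/2; the sum 2/3 stays below \<open>ln 2\<close>. Hence the factor 4 in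
    the case split and the divisor 6 here.\<close>
  define y where "y = (1 + Z) / 6"
  have "0 \<le> y" using assms(2) by (simp add: y_def)
  then have "y\<^sup>2 / 2 \<le> exp y" using exp_lower_Taylor_quadratic[of y] by linarith
  then have "((1 + Z) / 6)\<^sup>2 / 2 \<le> exp ((1 + Z) / 6)" by (simp add: y_def)
  then have "(1 + Z)\<^sup>2 \<le> 72 * exp ((1 + Z) / 6)" by (simp add: power_divide)
  then have "(1 + Z)\<^sup>2 * f \<le> (72 * exp ((1 + Z) / 6)) * (D * exp ((1 + Z) / 2))"
    using f_le f by (intro mult_mono) auto
  also have "\<dots> = 72 * D * exp ((1 + Z) * (2 / 3))"
    by (simp add: exp_add[symmetric] algebra_simps)
  also have "\<dots> \<le> 72 * D * (3 * exp (Z * ln 2))"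
  proof (rule mult_left_mono)
    have "exp ((1 + Z) * (2 / 3)) \<le> exp (1 + Z * ln 2)"
      using assms mult_left_mono[OF ln2_ge_two_thirds, of Z] by (simp add: algebra_simps)
    also have "\<dots> \<le> 3 * exp (Z * ln 2)" using exp_le by (simp add: exp_add)
    finally show "exp ((1 + Z) * (2 / 3)) \<le> 3 * exp (Z * ln 2)" .
  qed (use assms in simp)
  also have "\<dots> = 216 * D * exp (Z * ln 2)" by simp
  finally have "(1 + Z)\<^sup>2 * f \<le> 216 * D * exp (Z * ln 2)" .
  moreover have "0 \<le> 16 * ln (3 + L) ^ 2 * f" using f by simp
  ultimately show ?thesis by linarith
qed

text \<open>On the event of \<open>prob_total_deviation\<close> all deviations are controlled at
  level \<open>ln (d / \<delta>)\<close>. With \<open>D\<close> equal to \<open>d\<close> times this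
  level there is no excess, so \<open>regret_pathwise\<close> applies with
  \<open>Z = 0\<close>.\<close>

lemma high_probability_regret:
  assumes "c > 1" and "0 < a" "0 < b" and \<Psi>: "\<And>d \<delta>. \<lbrakk>d \<ge> 1; 0 < \<delta>; \<delta> < 1\<rbrakk> \<Longrightarrow>
      a * (d * ln (d / \<delta>)) \<le> \<Psi> d \<delta> \<and> \<Psi> d \<delta> \<le> b * (d * ln (d / \<delta>))"
  shows "\<exists>(C::real) (k::nat). \<forall>(d::nat) (T::nat) (\<delta>::real) (adv::adversary).
        d \<ge> 1 \<longrightarrow> \<delta> > 0 \<longrightarrow> valid_adversary d adv \<longrightarrow>
        measure_pmf.prob (bandit_run d c (\<Psi> d \<delta>) adv T)
          {h. regret d h \<le> C * polylog k d (best_loss d h) *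
                (sqrt (d * ln (d / \<delta>) * best_loss d h) + d * ln (d / \<delta>))} \<ge> 1 - \<delta>"
proof -
  obtain K where K: "K > 0"
    "\<And>d \<psi> D \<Lambda> Z h. \<lbrakk>d \<ge> 2; a * D \<le> \<psi>; \<psi> \<le> b * D; d * ln d \<le> D; 0 \<le> \<Lambda>; d * \<Lambda> \<le> D * (1 + Z); 0 \<le> Z;
       green_ix.feasible d c \<psi> h;
       \<And>\<tau> f. \<tau> \<le> length h \<Longrightarrow> f < d \<Longrightarrow> green_ix.deviation d c \<psi> \<tau> f h \<le> \<Lambda> + (real \<tau> + 1) * ln 2\<rbrakk>
      \<Longrightarrow> regret d h \<le> K * (1 + Z)\<^sup>2 * ln (3 + best_loss d h) * (sqrt (D * best_loss d h) + D)"
    using regret_pathwise[OF assms(2,3,1)] by blast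
  have "measure_pmf.prob (bandit_run d c (\<Psi> d \<delta>) adv T)
          {h. regret d h \<le> K * polylog 1 d (best_loss d h) *
                (sqrt (d * ln (d / \<delta>) * best_loss d h) + d * ln (d / \<delta>))} \<ge> 1 - \<delta>"
    if d: "d \<ge> 1" and \<delta>: "\<delta> > 0" and adv: "valid_adversary d adv" for d T :: nat and \<delta> :: real and adv
  proof (cases "\<delta> < 1")
    case False
    then have "1 - \<delta> \<le> 0" by simp
    then show ?thesis by (rule order_trans) (rule measure_nonneg)
  next
    case True
    have ln: "0 < ln (d / \<delta>)" using d \<delta> True by simp
    define D where "D = d * ln (d / \<delta>)"
    have D: "D > 0" using ln d by (simp add: D_def)
    note psi = \<Psi>[OF d \<delta> True, folded D_def]
    interpret green_ix d c "\<Psi> d \<delta>"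
      using d assms psi D by unfold_locales (auto intro: less_le_trans[of 0 "a * D"])
    have "1 - \<delta> \<le> measure_pmf.prob (bandit_run d c (\<Psi> d \<delta>) adv T) {h. total_deviation T h \<le> d / \<delta>}"
      by (rule prob_total_deviation[OF adv \<delta>])
    also have "\<dots> \<le> measure_pmf.prob (bandit_run d c (\<Psi> d \<delta>) adv T)
          {h. regret d h \<le> K * polylog 1 d (best_loss d h) * (sqrt (D * best_loss d h) + D)}"
    proof (rule measure_pmf.finite_measure_mono_AE)
      have "regret d h \<le> K * polylog 1 d (best_loss d h) * (sqrt (D * best_loss d h) + D)"
        if h: "h \<in> set_pmf (bandit_run d c (\<Psi> d \<delta>) adv T)" and dev: "total_deviation T h \<le> d / \<delta>" for h
      proof -
        have feas: "feasible h" and len: "length h = T" using feasible_bandit_run[OF adv h] by auto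
        note L = best_loss_bounds(1)[OF feas]
        note pl = polylog_ge[OF L, of 1 d]
        have rhs: "K * ln (3 + best_loss d h) * (sqrt (D * best_loss d h) + D)
            \<le> K * polylog 1 d (best_loss d h) * (sqrt (D * best_loss d h) + D)"
          using pl K(1) D L by (intro mult_right_mono mult_left_mono) auto
        show ?thesis
        proof (cases "d = 1")
          case True
          have "0 \<le> K * ln (3 + best_loss d h) * (sqrt (D * best_loss d h) + D)"
            using K(1) D L by (intro mult_nonneg_nonneg) auto
          then show ?thesis using rhs regret_single_arm[OF True feas] by simp
        next
          case False
          have "ln d \<le> ln (d / \<delta>)"
            using d \<delta> True by (subst ln_le_cancel_iff) (auto simp: le_divide_eq mult_left_le)
          then have "d * ln d \<le> D" unfolding D_def by (intro mult_left_mono) auto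
          moreover have "total_deviation T h \<le> exp (ln (d / \<delta>))" using dev d \<delta> by simp
          note deviation_le[OF this]
          ultimately have "regret d h \<le> K * (1 + 0)\<^sup>2 * ln (3 + best_loss d h) * (sqrt (D * best_loss d h) + D)"
            using d False psi ln feas len by (intro K(2)[of d D "\<Psi> d \<delta>" "ln (d / \<delta>)"]) (auto simp: D_def)
          then show ?thesis using rhs by simp
        qed
      qed
      then show "AE h in measure_pmf (bandit_run d c (\<Psi> d \<delta>) adv T). h \<in> {h. total_deviation T h \<le> d / \<delta>} \<longrightarrow>
          h \<in> {h. regret d h \<le> K * polylog 1 d (best_loss d h) * (sqrt (D * best_loss d h) + D)}"
        by (auto simp: AE_measure_pmf_iff)
    qed auto
    finally show ?thesis by (simp add: D_def)
  qed
  then show ?thesis by blast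
qed

text \<open>\<open>regret_pathwise\<close> is used with \<open>D = d * ln d\<close> and a random
  excess \<open>Z\<close> read off from \<open>total_deviation\<close>. The mean of
  \<open>exp (Z * ln 2)\<close> is at most 2, and \<open>powers_absorbed_by_exp\<close> separates
  \<open>Z\<close> from the random best loss.\<close>

lemma expected_regret:
  assumes "c > 1" and "0 < a" "0 < b" and \<delta>: "0 < \<delta>" "\<delta> < 1" and \<Psi>: "\<And>d. d \<ge> 1 \<Longrightarrow>
      a * (d * ln (d / \<delta>)) \<le> \<Psi> d \<delta> \<and> \<Psi> d \<delta> \<le> b * (d * ln (d / \<delta>))"
  shows "\<exists>(C::real) (k::nat). \<forall>(d::nat) (T::nat) (adv::adversary).
          d \<ge> 1 \<longrightarrow> valid_adversary d adv \<longrightarrow>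
          measure_pmf.expectation (bandit_run d c (\<Psi> d \<delta>) adv T) (regret d)
            \<le> measure_pmf.expectation (bandit_run d c (\<Psi> d \<delta>) adv T)
                (\<lambda>h. C * polylog k d (best_loss d h) *
                  (sqrt (d * ln d * best_loss d h) + d * ln d))"
proof -
  \<comment> \<open>For fixed \<open>\<delta>\<close> and \<open>d \<ge> 2\<close>,
    \<open>ln (1 / \<delta>)\<close> is at most a constant times \<open>ln d\<close>;
    \<open>b'\<close> is the resulting upper constant of \<open>\<Psi>\<close> relative to
    \<open>d * ln d\<close>.\<close>
  define b' where "b' = b * (1 + ln (1 / \<delta>) / ln 2)"
  have ln\<delta>: "0 \<le> ln (1 / \<delta>)" using \<delta> by simp
  then have "0 \<le> ln (1 / \<delta>) / ln 2" by simp
  then have b': "0 < b'" unfolding b'_def using assms(3) by (intro mult_pos_pos) linarith+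
  obtain K where K: "K > 0"
    "\<And>d \<psi> D \<Lambda> Z h. \<lbrakk>d \<ge> 2; a * D \<le> \<psi>; \<psi> \<le> b' * D; d * ln d \<le> D; 0 \<le> \<Lambda>; d * \<Lambda> \<le> D * (1 + Z); 0 \<le> Z;
       green_ix.feasible d c \<psi> h;
       \<And>\<tau> f. \<tau> \<le> length h \<Longrightarrow> f < d \<Longrightarrow> green_ix.deviation d c \<psi> \<tau> f h \<le> \<Lambda> + (real \<tau> + 1) * ln 2\<rbrakk>
      \<Longrightarrow> regret d h \<le> K * (1 + Z)\<^sup>2 * ln (3 + best_loss d h) * (sqrt (D * best_loss d h) + D)"
    using regret_pathwise[OF assms(2) b' assms(1)] by blast
  \<comment> \<open>448 = 16 + 2 * 216, with the two constants of
    \<open>powers_absorbed_by_exp\<close>.\<close>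
  define C where "C = K * 448"
  have "measure_pmf.expectation (bandit_run d c (\<Psi> d \<delta>) adv T) (regret d)
            \<le> measure_pmf.expectation (bandit_run d c (\<Psi> d \<delta>) adv T)
                (\<lambda>h. C * polylog 3 d (best_loss d h) *
                  (sqrt (d * ln d * best_loss d h) + d * ln d))"
    if d: "d \<ge> 1" and adv: "valid_adversary d adv" for d T :: nat and adv
  proof -
    have "0 < ln (d / \<delta>)" using d \<delta> by simp
    then have pos: "0 < d * ln (d / \<delta>)" using d by simp
    interpret green_ix d c "\<Psi> d \<delta>"
      using d assms(1,2) \<Psi>[OF d] pos
      by unfold_locales (auto intro: less_le_trans[of 0 "a * (d * ln (d / \<delta>))"])
    let ?M = "bandit_run d c (\<Psi> d \<delta>) adv T"
    define D where "D = d * ln d"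
    have supp: "feasible h" "length h = T" if "h \<in> set_pmf ?M" for h
      using feasible_bandit_run[OF adv that] by auto
    show ?thesis
    proof (cases "d = 1")
      case True
      have "measure_pmf.expectation ?M (regret d) = measure_pmf.expectation ?M (\<lambda>_. 0)"
        using supp regret_single_arm[OF True] by (intro integral_cong_AE) (auto simp: AE_measure_pmf_iff)
      then show ?thesis by (simp add: True)
    next
      case False
      then have d2: "d \<ge> 2" using d by simp
      have lnd: "ln 2 \<le> ln d" using d2 by (subst ln_le_cancel_iff) auto
      have lnd0: "ln d > 0" using d2 by simp
      have D1: "1 \<le> D"
      proof -
        have "1 / 2 \<le> ln d" using lnd ln2_ge_two_thirds by linarith
        then have "2 * (1 / 2) \<le> real d * ln d"
          using d2 by (intro mult_mono) auto
        then show ?thesis by (simp add: D_def)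
      qed
      have "ln (d / \<delta>) = ln d + ln (1 / \<delta>)" using d2 \<delta> by (simp add: ln_div)
      also have "ln (1 / \<delta>) \<le> ln (1 / \<delta>) / ln 2 * ln d"
        using mult_left_mono[OF lnd ln\<delta>] by (simp add: field_simps)
      finally have "ln (d / \<delta>) \<le> (1 + ln (1 / \<delta>) / ln 2) * ln d" by (simp add: algebra_simps)
      then have "d * ln (d / \<delta>) \<le> d * ((1 + ln (1 / \<delta>) / ln 2) * ln d)" by (intro mult_left_mono) auto
      then have "b * (d * ln (d / \<delta>)) \<le> b * (d * ((1 + ln (1 / \<delta>) / ln 2) * ln d))"
        by (rule mult_left_mono) (use assms(3) in simp)
      also have "\<dots> = b' * D" by (simp add: b'_def D_def mult_ac)
      finally have psi_le: "\<Psi> d \<delta> \<le> b' * D" using \<Psi>[OF d] by simp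
      have "ln d \<le> ln (d / \<delta>)"
        using d \<delta> by (subst ln_le_cancel_iff) (auto simp: le_divide_eq mult_left_le)
      then have "a * D \<le> a * (d * ln (d / \<delta>))"
        unfolding D_def using assms(2) by (intro mult_left_mono) auto
      then have psi_ge: "a * D \<le> \<Psi> d \<delta>" using \<Psi>[OF d] by simp
      define F where "F = (\<lambda>L. ln (3 + L) * (sqrt (D * L) + D))"
      define H where "H = (\<lambda>L. C * polylog 3 d L * (sqrt (D * L) + D))"
      \<comment> \<open>Normalised so that its mean is at most 1.\<close>
      define G where "G = (\<lambda>h. total_deviation T h / d)"
      have "regret d h \<le> K * (16 * ln (3 + best_loss d h) ^ 2 * F (best_loss d h) + 216 * D * (1 + G h))"
        if h: "h \<in> set_pmf ?M" for h
      proof -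
        \<comment> \<open>The least nonnegative \<open>Z\<close> for which \<open>G h\<close> is at
          most the \<open>Z\<close>-th power of \<open>d\<close>; this makes
          \<open>total_deviation T h\<close> at most \<open>exp \<Lambda>\<close> below.\<close>
        define Z where "Z = max 0 (ln (G h) / ln d)"
        have Z: "Z \<ge> 0" by (simp add: Z_def)
        have G: "G h \<ge> 0" using total_deviation_nonneg d by (simp add: G_def)
        have le: "G h \<le> exp (Z * ln d)"
        proof (cases "G h > 0")
          case True
          have "ln (G h) \<le> Z * ln d" using lnd0 by (simp add: Z_def max_mult_distrib_right)
          then show ?thesis using True by (metis exp_le_cancel_iff exp_ln)
        qed (use order_trans[OF _ exp_ge_zero] in auto)
        have exp_Z: "exp (Z * ln 2) \<le> 1 + G h"
        proof (cases "Z = 0")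
          case False
          then have z: "Z = ln (G h) / ln d" by (auto simp: Z_def max_def split: if_splits)
          then have "ln (G h) / ln d > 0" using False Z by linarith
          then have "ln (G h) > 0" using lnd0 by (simp add: zero_less_divide_iff)
          \<comment> \<open>The default value \<open>ln 0 = 0\<close> excludes
            \<open>G h = 0\<close>.\<close>
          then have "G h > 0" using G by (cases "G h = 0") auto
          have "Z * ln 2 \<le> Z * ln d" using Z lnd by (intro mult_left_mono)
          also have "\<dots> = ln (G h)" using z lnd0 by simp
          finally have "exp (Z * ln 2) \<le> exp (ln (G h))" by simp
          also have "\<dots> = G h" using \<open>G h > 0\<close> by simp
          finally show ?thesis by simp
        qed (use G in simp)
        define \<Lambda> where "\<Lambda> = ln d * (1 + Z)"
        have "total_deviation T h = d * G h" using d by (simp add: G_def)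
        also have "\<dots> \<le> d * exp (Z * ln d)" using le by (intro mult_left_mono) auto
        also have "\<dots> = exp \<Lambda>" using d2 by (simp add: \<Lambda>_def algebra_simps exp_add)
        finally have dev: "total_deviation T h \<le> exp \<Lambda>" .
        note L = best_loss_bounds(1)[OF supp(1)[OF h]]
        have "regret d h \<le> K * (1 + Z)\<^sup>2 * ln (3 + best_loss d h) * (sqrt (D * best_loss d h) + D)"
          using d2 psi_ge psi_le Z lnd0 supp[OF h] deviation_le[OF dev]
          by (intro K(2)[of d D "\<Psi> d \<delta>" \<Lambda>]) (auto simp: \<Lambda>_def D_def)
        also have "\<dots> = K * ((1 + Z)\<^sup>2 * F (best_loss d h))" by (simp add: F_def)
        also have "\<dots> \<le> K * (16 * ln (3 + best_loss d h) ^ 2 * F (best_loss d h) + 216 * D * exp (Z * ln 2))"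
          using powers_absorbed_by_exp[OF L Z D1] K(1) by (intro mult_left_mono) (auto simp: F_def)
        also have "\<dots> \<le> K * (16 * ln (3 + best_loss d h) ^ 2 * F (best_loss d h) + 216 * D * (1 + G h))"
          using exp_Z K(1) D1 by (intro mult_left_mono add_left_mono) auto
        finally show ?thesis .
      qed
      moreover have "K * (16 * ln (3 + L) ^ 2 * F L + 432 * D) \<le> H L" if L: "0 \<le> L" for L
      proof -
        note l = ln_three_plus_ge_1[OF L]
        have P: "0 \<le> sqrt (D * L) + D" using D1 L by simp
        have "1 * D \<le> ln (3 + L) ^ 3 * (sqrt (D * L) + D)"
          using l D1 L by (intro mult_mono) auto
        moreover have "ln (3 + L) ^ 2 * F L = ln (3 + L) ^ 3 * (sqrt (D * L) + D)"
          by (simp add: F_def power3_eq_cube power2_eq_square)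
        ultimately have "16 * ln (3 + L) ^ 2 * F L + 432 * D \<le> 448 * (ln (3 + L) ^ 3 * (sqrt (D * L) + D))"
          by simp
        also have "\<dots> \<le> 448 * (polylog 3 d L * (sqrt (D * L) + D))"
          using polylog_ge[OF L, of 3 d] P by (intro mult_left_mono mult_right_mono) auto
        finally have "K * (16 * ln (3 + L) ^ 2 * F L + 432 * D) \<le> K * (448 * (polylog 3 d L * (sqrt (D * L) + D)))"
          using K(1) by (intro mult_left_mono) auto
        then show ?thesis by (simp add: H_def C_def mult_ac)
      qed
      \<comment> \<open>The remainder is centred by writing \<open>1 + G h\<close> as
        \<open>2 + (G h - 1)\<close>: the 2 goes into \<open>H\<close>, and the rest has mean at
        most 0.\<close>
      ultimately have bound: "regret d h \<le> H (best_loss d h) + K * 216 * D * (G h - 1)"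
        if "h \<in> set_pmf ?M" for h
        using that best_loss_bounds(1)[OF supp(1)[OF that]] by (fastforce simp: algebra_simps)
      \<comment> \<open>Serves the integrability of \<open>H (best_loss d h)\<close>, as the best
        loss lies between 0 and \<open>T\<close>.\<close>
      have H_mono: "H L \<le> H L'" "0 \<le> H L" if "0 \<le> L" "L \<le> L'" for L L'
      proof -
        have l: "1 \<le> ln (3 + real d)" "1 \<le> ln (3 + L)" "ln (3 + L) \<le> ln (3 + L')"
          using ln_three_plus_ge_1 that by auto
        have C: "0 \<le> C" using K(1) by (simp add: C_def)
        have "ln (3 + real d) * ln (3 + L) \<le> ln (3 + real d) * ln (3 + L')"
          using l by (intro mult_left_mono) auto
        moreover have "0 \<le> ln (3 + real d) * ln (3 + L)"
          using l by (intro mult_nonneg_nonneg) linarith+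
        ultimately have p: "polylog 3 d L \<le> polylog 3 d L'" "0 \<le> polylog 3 d L"
          unfolding polylog_def by (rule power_mono, simp)
        have q: "sqrt (D * L) + D \<le> sqrt (D * L') + D" "0 \<le> sqrt (D * L) + D"
          using that D1 by auto
        show "0 \<le> H L"
          unfolding H_def by (intro mult_nonneg_nonneg C p q)
        show "H L \<le> H L'"
          unfolding H_def using C p q by (intro mult_mono mult_nonneg_nonneg) auto
      qed
      have int_H: "integrable ?M (\<lambda>h. H (best_loss d h))"
      proof (rule measure_pmf.integrable_const_bound)
        have "norm (H (best_loss d h)) \<le> H T" if h: "h \<in> set_pmf ?M" for h
        proof -
          have "0 \<le> best_loss d h" "best_loss d h \<le> T"
            using best_loss_bounds[OF supp(1)[OF h]] supp(2)[OF h] by auto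
          from H_mono[OF this] show ?thesis by simp
        qed
        then show "AE h in ?M. norm (H (best_loss d h)) \<le> H T" by (simp add: AE_measure_pmf_iff)
      qed simp
      have int_G: "integrable ?M G"
        unfolding G_def using integrable_total_deviation[OF adv] by simp
      have int_R: "integrable ?M (regret d)"
      proof (rule measure_pmf.integrable_const_bound)
        have "norm (regret d h) \<le> T" if h: "h \<in> set_pmf ?M" for h
          using regret_bounds[OF supp(1)[OF h]] supp(2)[OF h] by simp
        then show "AE h in ?M. norm (regret d h) \<le> T" by (simp add: AE_measure_pmf_iff)
      qed simp
      have EG: "measure_pmf.expectation ?M G \<le> 1"
        unfolding G_def using expectation_total_deviation[OF adv, of T] d by simp
      have "measure_pmf.expectation ?M (regret d)
          \<le> measure_pmf.expectation ?M (\<lambda>h. H (best_loss d h) + K * 216 * D * (G h - 1))"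
      proof (rule integral_mono_AE[OF int_R])
        show "integrable ?M (\<lambda>h. H (best_loss d h) + K * 216 * D * (G h - 1))"
          using int_H int_G by simp
        show "AE h in ?M. regret d h \<le> H (best_loss d h) + K * 216 * D * (G h - 1)"
          using bound by (simp add: AE_measure_pmf_iff)
      qed
      also have "\<dots> = measure_pmf.expectation ?M (\<lambda>h. H (best_loss d h))
          + K * 216 * D * (measure_pmf.expectation ?M G - 1)"
        using int_H int_G by simp
      also have "\<dots> \<le> measure_pmf.expectation ?M (\<lambda>h. H (best_loss d h))"
        using EG K(1) D1 by (simp add: mult_nonneg_nonpos)
      finally show ?thesis by (simp add: H_def D_def)
    qed
  qed
  then show ?thesis by blast
qed

theorem corollary4p1:
  fixes c :: real and \<Psi> :: "nat \<Rightarrow> real \<Rightarrow> real"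
  assumes "c > 1" and "is_Theta_dlog \<Psi>"
  shows
    "(\<exists>(C::real) (k::nat). \<forall>(d::nat) (T::nat) (\<delta>::real) (adv::adversary).
        d \<ge> 1 \<longrightarrow> \<delta> > 0 \<longrightarrow> valid_adversary d adv \<longrightarrow>
        measure_pmf.prob (bandit_run d c (\<Psi> d \<delta>) adv T)
          {h. regret d h \<le> C * polylog k d (best_loss d h) *
                (sqrt (d * ln (d / \<delta>) * best_loss d h) + d * ln (d / \<delta>))} \<ge> 1 - \<delta>)
     \<and> (\<forall>\<delta>::real. 0 < \<delta> \<and> \<delta> < 1 \<longrightarrow>
        (\<exists>(C::real) (k::nat). \<forall>(d::nat) (T::nat) (adv::adversary).
          d \<ge> 1 \<longrightarrow> valid_adversary d adv \<longrightarrow>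
          measure_pmf.expectation (bandit_run d c (\<Psi> d \<delta>) adv T) (regret d)
            \<le> measure_pmf.expectation (bandit_run d c (\<Psi> d \<delta>) adv T)
                (\<lambda>h. C * polylog k d (best_loss d h) *
                  (sqrt (d * ln d * best_loss d h) + d * ln d))))"
proof -
  obtain a b where ab: "0 < a" "0 < b" and \<Psi>: "\<And>d \<delta>. \<lbrakk>d \<ge> 1; 0 < \<delta>; \<delta> < 1\<rbrakk> \<Longrightarrow>
      a * (d * ln (d / \<delta>)) \<le> \<Psi> d \<delta> \<and> \<Psi> d \<delta> \<le> b * (d * ln (d / \<delta>))"
    using assms(2) unfolding is_Theta_dlog_def by blast
  show ?thesis
    by (intro conjI allI impI high_probability_regret[OF assms(1) ab \<Psi>]
        expected_regret[OF assms(1) ab _ _ \<Psi>]) auto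
qed

end
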